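(* Let $n\ge 2$ be even and let the inter-agent graph be the undirected ring, $\mathcal N_i=\{i-1,i+1\}$ for all $i\in\mathcal V$ (indices modulo $n$). Consider the closed-loop system on $(\mathcal S^2)^n$ $$\dot\Gamma_i=\Gamma_i\times\Big(\Gamma_i\times\sum_{j\in\mathcal N_i}\Gamma_j\Big),\qquad i=1,\dots,n.$$ Then, as time tends to infinity, every trajectory of this system approaches one of its equilibrium manifolds, among which $$\mathcal M_e=\{\mathbf\Gamma\in(\mathcal S^2)^n:\ \exists v\in\mathcal S^2 \text{ with } \Gamma_i=(-1)^{i-1}v\ \ \forall i\in\mathcal V\}$$ is the only stable one.
   Context: $\mathcal S^2=\{x\in\mathbb R^3:\|x\|=1\}$, $\mathcal V=\{1,\dots,n\}$, and indices are taken modulo $n$ (so $n+1$ means $1$ and $0$ means $n$). $\mathcal N_i$ is the set (not multiset) of neighbors of agent $i$. Points of $(\mathcal S^2)^n$ are written $\mathbf\Gamma=\{\Gamma_i\}_{i\in\mathcal V}$. The metric is $d_{(\mathcal S^2)^n}(\mathbf\Gamma,\bar{\mathbf\Gamma})=\max_i\arccos(\Gamma_i^T\bar\Gamma_i)$, and $d_{\mathcal M}(\mathbf\Gamma)=\inf_{\bar{\mathbf\Gamma}\in\mathcal M}d_{(\mathcal S^2)^n}(\mathbf\Gamma,\bar{\mathbf\Gamma})$. The equilibrium manifolds of the system are the connected components of its set of equilibria. A trajectory approaches a set $\mathcal M$ if $d_{\mathcal M}(\mathbf\Gamma(t))\to0$ as $t\to\infty$. A positively invariant set $\mathcal M$ is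 stable if for every $\varepsilon>0$ there is $\delta>0$ such that $d_{\mathcal M}(\mathbf\Gamma(0))<\delta$ implies $d_{\mathcal M}(\mathbf\Gamma(t))<\varepsilon$ for all $t\ge0$. *)

theory Defs
  imports "HOL-Analysis.Analysis"
begin

text \<open>
  A point of the n-fold power of the 2-sphere is an extensional function on {1..n}, so that
  distinct functions are distinct points. On these functions the topology of the function type
  (pointwise convergence) is that of the finite product, which is also the one induced by
  the metric \<open>config_dist\<close> below.
\<close>

definition configs :: "nat \<Rightarrow> (nat \<Rightarrow> real^3) set" where
  "configs n = (\<Pi>\<^sub>E i\<in>{1..n}. sphere 0 1)"

text \<open>Neighbours form a set, so for n = 2 each agent has a single neighbour, counted once.\<close>

definition ring_nbrs :: "nat \<Rightarrow> nat \<Rightarrow> nat set" where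
  "ring_nbrs n i = {if i = 1 then n else i - 1, if i = n then 1 else i + 1}"

definition ring_field :: "nat \<Rightarrow> (nat \<Rightarrow> real^3) \<Rightarrow> nat \<Rightarrow> real^3" where
  "ring_field n \<Gamma> i = cross3 (\<Gamma> i) (cross3 (\<Gamma> i) (\<Sum>j\<in>ring_nbrs n i. \<Gamma> j))"

text \<open>
  Trajectories are forward solutions on the whole half-line; since the phase space is compact
  and the vector field is smooth, every maximal forward solution is of this kind.
\<close>

definition trajectory :: "nat \<Rightarrow> (real \<Rightarrow> nat \<Rightarrow> real^3) \<Rightarrow> bool" where
  "trajectory n x \<longleftrightarrow>
     (\<forall>t\<ge>0. x t \<in> configs n) \<and>
     (\<forall>t\<ge>0. \<forall>i\<in>{1..n}.
        ((\<lambda>s. x s i) has_vector_derivative ring_field n (x t) i) (at t within {0..}))"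

definition equilibria :: "nat \<Rightarrow> (nat \<Rightarrow> real^3) set" where
  "equilibria n = {\<Gamma> \<in> configs n. \<forall>i\<in>{1..n}. ring_field n \<Gamma> i = 0}"

definition equilibrium_manifolds :: "nat \<Rightarrow> (nat \<Rightarrow> real^3) set set" where
  "equilibrium_manifolds n = components (equilibria n)"

definition config_dist :: "nat \<Rightarrow> (nat \<Rightarrow> real^3) \<Rightarrow> (nat \<Rightarrow> real^3) \<Rightarrow> real" where
  "config_dist n \<Gamma> \<Gamma>' = (MAX i\<in>{1..n}. arccos (\<Gamma> i \<bullet> \<Gamma>' i))"

definition config_setdist :: "nat \<Rightarrow> (nat \<Rightarrow> real^3) set \<Rightarrow> (nat \<Rightarrow> real^3) \<Rightarrow> real" where
  "config_setdist n M \<Gamma> = (INF \<Gamma>'\<in>M. config_dist n \<Gamma> \<Gamma>')"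

definition approaches :: "nat \<Rightarrow> (real \<Rightarrow> nat \<Rightarrow> real^3) \<Rightarrow> (nat \<Rightarrow> real^3) set \<Rightarrow> bool" where
  "approaches n x M \<longleftrightarrow> ((\<lambda>t. config_setdist n M (x t)) \<longlongrightarrow> 0) at_top"

definition positively_invariant :: "nat \<Rightarrow> (nat \<Rightarrow> real^3) set \<Rightarrow> bool" where
  "positively_invariant n M \<longleftrightarrow>
     M \<subseteq> configs n \<and> (\<forall>x. trajectory n x \<longrightarrow> x 0 \<in> M \<longrightarrow> (\<forall>t\<ge>0. x t \<in> M))"

text \<open>
  For closed nonempty M (in particular for equilibrium manifolds) positive invariance already
  follows from the epsilon-delta condition, so the first conjunct never causes instability there.
\<close>

definition stable_set :: "nat \<Rightarrow> (nat \<Rightarrow> real^3) set \<Rightarrow> bool" where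
  "stable_set n M \<longleftrightarrow>
     positively_invariant n M \<and>
     (\<forall>\<epsilon>>0. \<exists>\<delta>>0. \<forall>x. trajectory n x \<longrightarrow> config_setdist n M (x 0) < \<delta> \<longrightarrow>
        (\<forall>t\<ge>0. config_setdist n M (x t) < \<epsilon>))"

definition alternating_manifold :: "nat \<Rightarrow> (nat \<Rightarrow> real^3) set" where
  "alternating_manifold n =
     {\<Gamma> \<in> configs n. \<exists>v\<in>sphere 0 1. \<forall>i\<in>{1..n}. \<Gamma> i = (-1) ^ (i - 1) *\<^sub>R v}"

end

theory Submission
  imports Defs "HOL-Probability.Discrete_Topology"
begin

text \<open>
  On a configuration the right-hand side of agent i is minus the part of its neighbour sum that is
  tangent to the sphere at \<^term>\<open>\<Gamma> i\<close>. The system is therefore, up to a constant factor, the gradient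
  descent of the energy \<open>\<Sum>i. \<Gamma> i \<bullet> \<Gamma> (i + 1)\<close>, which decreases at a rate proportional to the
  sum of the squared speeds (\<open>energy_has_derivative\<close>).

  Convergence is LaSalle's principle. The speeds tend to zero because the energy is bounded below
  and the field is Lipschitz (\<open>ring_field_vanishes\<close>), so the omega-limit set of a trajectory consists of
  equilibria. It is also nonempty and connected and attracts the trajectory; hence it lies in one
  connected component of the set of equilibria, and the trajectory approaches that component.

  Stability rests on two properties of the energy. First, it takes only finitely many values on
  equilibria (\<open>finite_critical_values\<close>). At an equilibrium, agent \<open>i + 2\<close> is either the opposite of
  agent i or the reflection of agent i in the line through agent \<open>i + 1\<close>. The configuration thus
  stays on one great circle, and read as complex numbers its successive quotients are all equal
  to \<open>w\<close> or to \<open>- cnj w\<close> for one unit number \<open>w\<close>. Closing up after n steps makes \<open>w\<close> a root of unity of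
  bounded order, unless both quotients occur equally often, and then the energy is zero.
  Secondly, a configuration with two neighbours that are not antipodal is never a local minimum of the
  energy (\<open>energy_descent_near_nonalternating\<close>): push agent i in the direction \<open>(-1)^i u\<close> and
  average over \<open>u\<close> in the six directions of the coordinate axes. The first-order terms cancel and the
  second-order term is a negative multiple of the sum of the squares of
  \<open>1 + \<Gamma> i \<bullet> \<Gamma> (i + 1)\<close>. This is where a sphere of dimension two is used, as opposed to a circle.

  The alternating configurations are exactly those of minimal energy. They form a full component, since
  on a connected set of equilibria the energy is constant by finiteness, and they are stable because
  sublevel sets of the energy are invariant. Any other component M contains a point of least energy
  on M, and arbitrarily close to it there are configurations of smaller energy. A trajectory that
  starts at one of them has a limit equilibrium whose energy lies below that of M by a gap not
  depending on the start, so it leaves a fixed neighbourhood of M. This last step needs solutions to exist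
  (\<open>trajectory_exists\<close>): the field is made globally Lipschitz by projecting onto the unit
  ball, and the contraction principle is applied on the half-line with a weighted norm.
\<close>

section \<open>The field as an energy gradient\<close>

definition ring_succ :: "nat \<Rightarrow> nat \<Rightarrow> nat" where
  "ring_succ n i = (if i = n then 1 else i + 1)"

definition ring_pred :: "nat \<Rightarrow> nat \<Rightarrow> nat" where
  "ring_pred n i = (if i = 1 then n else i - 1)"

text \<open>
  For n = 2 both ring neighbours are the same agent, which enters the neighbour sum once. With this
  factor the sum is always a multiple of predecessor plus successor, and the case needs no separate
  treatment.
\<close>

definition coupling :: "nat \<Rightarrow> real" where
  "coupling n = (if n = 2 then 1/2 else 1)"

definition energy :: "nat \<Rightarrow> (nat \<Rightarrow> real^3) \<Rightarrow> real" where
  "energy n \<Gamma> = (\<Sum>i=1..n. \<Gamma> i \<bullet> \<Gamma> (ring_succ n i))"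

lemma coupling_pos: "coupling n > 0" and coupling_le_1: "coupling n \<le> 1"
  by (auto simp: coupling_def)

lemma ring_succ_in: "i \<in> {1..n} \<Longrightarrow> ring_succ n i \<in> {1..n}"
  by (auto simp: ring_succ_def)

lemma ring_pred_in: "i \<in> {1..n} \<Longrightarrow> ring_pred n i \<in> {1..n}"
  by (auto simp: ring_pred_def)

lemma ring_pred_succ: "i \<in> {1..n} \<Longrightarrow> ring_pred n (ring_succ n i) = i"
  by (auto simp: ring_pred_def ring_succ_def)

lemma ring_succ_pred: "i \<in> {1..n} \<Longrightarrow> ring_succ n (ring_pred n i) = i"
  by (auto simp: ring_pred_def ring_succ_def)

lemma bij_betw_ring_succ: "bij_betw (ring_succ n) {1..n} {1..n}"
  by (rule bij_betw_byWitness[where f' = "ring_pred n"])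
     (use ring_pred_succ ring_succ_pred ring_succ_in ring_pred_in in blast)+

lemma sum_ring_succ: "(\<Sum>i=1..n. g (ring_succ n i)) = (\<Sum>i=1..n. g i)"
  by (rule sum.reindex_bij_betw[OF bij_betw_ring_succ])

lemma sum_ring_nbrs:
  fixes g :: "nat \<Rightarrow> 'a::real_vector"
  assumes "n \<ge> 2" "i \<in> {1..n}"
  shows "(\<Sum>j\<in>ring_nbrs n i. g j) = coupling n *\<^sub>R (g (ring_pred n i) + g (ring_succ n i))"
proof (cases "n = 2")
  case True
  then have "ring_nbrs n i = {ring_succ n i}" "ring_pred n i = ring_succ n i"
    using assms by (auto simp: ring_nbrs_def ring_succ_def ring_pred_def)
  then show ?thesis
    using True by (simp add: coupling_def scaleR_2[symmetric])
next
  case False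
  then have "ring_nbrs n i = {ring_pred n i, ring_succ n i}" "ring_pred n i \<noteq> ring_succ n i"
    using assms by (auto simp: ring_nbrs_def ring_succ_def ring_pred_def)
  then show ?thesis
    using False by (simp add: coupling_def)
qed

lemma configs_norm: "\<Gamma> \<in> configs n \<Longrightarrow> i \<in> {1..n} \<Longrightarrow> norm (\<Gamma> i) = 1"
  unfolding configs_def by (drule PiE_mem) auto

lemma configs_inner: "\<Gamma> \<in> configs n \<Longrightarrow> i \<in> {1..n} \<Longrightarrow> \<Gamma> i \<bullet> \<Gamma> i = 1"
  using configs_norm[of \<Gamma> n i] by (simp add: norm_eq_1)

lemma inner_bounds_unit:
  assumes "norm u = 1" "norm v = 1"
  shows "-1 \<le> u \<bullet> v" "u \<bullet> v \<le> 1" "\<bar>u \<bullet> v\<bar> \<le> 1"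
  using Cauchy_Schwarz_ineq2[of u v] assms by auto

lemma ring_field_eq:
  assumes "n \<ge> 2" "\<Gamma> \<in> configs n" "i \<in> {1..n}"
  defines "h \<equiv> \<Gamma> (ring_pred n i) + \<Gamma> (ring_succ n i)"
  shows "ring_field n \<Gamma> i = coupling n *\<^sub>R ((\<Gamma> i \<bullet> h) *\<^sub>R \<Gamma> i - h)"
  unfolding ring_field_def Lagrange sum_ring_nbrs[OF assms(1,3)] configs_inner[OF assms(2,3)] h_def
  by (simp add: scaleR_diff_right)

text \<open>
  The field is minus a tangential projection, so pairing it with the vector that is projected returns,
  up to a negative factor, its own squared length. This is the identity that makes the energy a Lyapunov function.
\<close>

lemma ring_field_inner:
  assumes "n \<ge> 2" "\<Gamma> \<in> configs n" "i \<in> {1..n}"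
  shows "ring_field n \<Gamma> i \<bullet> (\<Gamma> (ring_pred n i) + \<Gamma> (ring_succ n i))
    = - (norm (ring_field n \<Gamma> i))\<^sup>2 / coupling n"
proof -
  define h where "h = \<Gamma> (ring_pred n i) + \<Gamma> (ring_succ n i)"
  define g where "g = \<Gamma> i"
  have g: "g \<bullet> g = 1"
    using configs_inner[OF assms(2,3)] by (simp add: g_def)
  have "((g \<bullet> h) *\<^sub>R g - h) \<bullet> ((g \<bullet> h) *\<^sub>R g - h) = - (((g \<bullet> h) *\<^sub>R g - h) \<bullet> h)"
    by (simp add: inner_diff_left inner_diff_right inner_commute g algebra_simps)
  then show ?thesis
    using coupling_pos[of n]
    unfolding ring_field_eq[OF assms] h_def[symmetric] g_def[symmetric] power2_norm_eq_inner
      inner_scaleR_left inner_scaleR_right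
    by simp
qed

lemma energy_has_derivative:
  assumes n: "n \<ge> 2" and x: "trajectory n x" and t: "t \<ge> 0"
  shows "((\<lambda>s. energy n (x s)) has_real_derivative
      - (\<Sum>i=1..n. (norm (ring_field n (x t) i))\<^sup>2) / coupling n) (at t within {0..})"
proof -
  have cf: "x t \<in> configs n"
    and D: "\<And>i. i \<in> {1..n} \<Longrightarrow>
      ((\<lambda>s. x s i) has_vector_derivative ring_field n (x t) i) (at t within {0..})"
    using x t by (auto simp: trajectory_def)
  let ?f = "ring_field n (x t)" and ?S = "ring_succ n" and ?P = "ring_pred n"
  have "((\<lambda>s. x s i \<bullet> x s (?S i)) has_vector_derivative x t i \<bullet> ?f (?S i) + ?f i \<bullet> x t (?S i))
      (at t within {0..})" if "i \<in> {1..n}" for i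
    by (rule bounded_bilinear.has_vector_derivative[OF bounded_bilinear_inner])
       (use D that ring_succ_in in blast)+
  then have "((\<lambda>s. energy n (x s)) has_vector_derivative
      (\<Sum>i=1..n. x t i \<bullet> ?f (?S i) + ?f i \<bullet> x t (?S i))) (at t within {0..})"
    unfolding energy_def by (rule has_vector_derivative_sum)
  also have "(\<Sum>i=1..n. x t i \<bullet> ?f (?S i) + ?f i \<bullet> x t (?S i))
      = (\<Sum>i=1..n. x t (?P (?S i)) \<bullet> ?f (?S i)) + (\<Sum>i=1..n. ?f i \<bullet> x t (?S i))"
    by (simp add: sum.distrib ring_pred_succ)
  \<comment> \<open>Each edge is shifted by one, so that every summand contains the velocity of the same agent.\<close>
  also have "\<dots> = (\<Sum>i=1..n. x t (?P i) \<bullet> ?f i) + (\<Sum>i=1..n. ?f i \<bullet> x t (?S i))"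
    by (subst sum_ring_succ[of "\<lambda>i. x t (?P i) \<bullet> ?f i"]) simp
  also have "\<dots> = (\<Sum>i=1..n. ?f i \<bullet> (x t (?P i) + x t (?S i)))"
    by (simp add: sum.distrib inner_add_right inner_commute)
  also have "\<dots> = (\<Sum>i=1..n. - (norm (?f i))\<^sup>2 / coupling n)"
    by (rule sum.cong) (simp_all add: ring_field_inner[OF n cf])
  also have "\<dots> = - (\<Sum>i=1..n. (norm (?f i))\<^sup>2) / coupling n"
    by (simp add: sum_negf sum_divide_distrib)
  finally show ?thesis
    by (simp add: has_real_derivative_iff_has_vector_derivative)
qed

lemma energy_continuous_on_time:
  assumes "n \<ge> 2" "trajectory n x"
  shows "continuous_on {0..} (\<lambda>t. energy n (x t))"
  using energy_has_derivative[OF assms]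
  by (auto simp: continuous_on_eq_continuous_within intro: DERIV_continuous)

lemma energy_antimono:
  assumes n: "n \<ge> 2" and x: "trajectory n x" and st: "0 \<le> s" "s \<le> t"
  shows "energy n (x t) \<le> energy n (x s)"
proof (rule DERIV_nonpos_imp_decreasing_open[OF st(2)])
  fix r assume "s < r" "r < t"
  then have "((\<lambda>s. energy n (x s)) has_real_derivative
      - (\<Sum>i=1..n. (norm (ring_field n (x r) i))\<^sup>2) / coupling n) (at r)"
    using energy_has_derivative[OF n x, of r] st at_within_interior[of r "{0..}"]
    by simp
  moreover have "- (\<Sum>i=1..n. (norm (ring_field n (x r) i))\<^sup>2) / coupling n \<le> 0"
    using coupling_pos[of n] by (simp add: sum_nonneg)
  ultimately show "\<exists>y. ((\<lambda>t. energy n (x t)) has_real_derivative y) (at r) \<and> y \<le> 0"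
    by blast
next
  show "continuous_on {s..t} (\<lambda>t. energy n (x t))"
    using energy_continuous_on_time[OF n x] by (rule continuous_on_subset) (use st in auto)
qed

section \<open>Compactness and the distance to a set\<close>

text \<open>
  Outside the index range a configuration has the value \<^term>\<open>undefined\<close>; seen as a product over all
  natural numbers, those factors are singletons, and Tychonoff's theorem applies.
\<close>

lemma compact_configs: "compact (configs n)"
proof -
  have "compactin (product_topology (\<lambda>i. euclidean) UNIV)
      (PiE UNIV (\<lambda>i. if i \<in> {1..n} then sphere (0::real^3) 1 else {undefined}))"
    by (subst compactin_PiE) auto
  moreover have "(PiE UNIV (\<lambda>i. if i \<in> {1..n} then sphere (0::real^3) 1 else {undefined})) = configs n"
    by (auto simp: configs_def PiE_def Pi_def extensional_def split: if_splits)
  ultimately show ?thesis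
    by (simp add: euclidean_product_topology)
qed

lemma closed_configs: "closed (configs n)"
  by (rule compact_imp_closed[OF compact_configs])

lemma continuous_on_energy: "continuous_on S (energy n)"
  unfolding energy_def
  by (intro continuous_intros continuous_on_subset[OF continuous_on_product_coordinates]) auto

lemma continuous_on_ring_field: "continuous_on S (\<lambda>\<Gamma>. ring_field n \<Gamma> i)"
  unfolding ring_field_def
  by (intro continuous_on_cross continuous_intros
      continuous_on_subset[OF continuous_on_product_coordinates]) auto

lemma closed_equilibria: "closed (equilibria n)"
proof -
  have "equilibria n = configs n \<inter> (\<Inter>i\<in>{1..n}. {\<Gamma>. ring_field n \<Gamma> i = 0})"
    by (auto simp: equilibria_def)
  moreover have "closed {\<Gamma>. ring_field n \<Gamma> i = 0}" for i
    using continuous_on_ring_field by (intro closed_Collect_eq) auto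
  ultimately show ?thesis
    using closed_configs by (simp add: closed_Int closed_INT)
qed

lemma equilibrium_manifold_props:
  assumes "M \<in> equilibrium_manifolds n"
  shows "compact M" "M \<noteq> {}" "M \<subseteq> configs n" "M \<subseteq> equilibria n"
proof -
  have M: "M \<in> components (equilibria n)"
    using assms by (simp add: equilibrium_manifolds_def)
  show eq: "M \<subseteq> equilibria n" and "M \<noteq> {}"
    using in_components_subset[OF M] in_components_nonempty[OF M] by auto
  then show cf: "M \<subseteq> configs n"
    by (auto simp: equilibria_def)
  show "compact M"
    using closed_components[OF closed_equilibria M] cf compact_configs closed_configs
    by (metis compact_Int_closed inf.absorb_iff2)
qed

lemma angle_bounds:
  assumes "\<Gamma> \<in> configs n" "\<Gamma>' \<in> configs n" "i \<in> {1..n}"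
  shows "0 \<le> arccos (\<Gamma> i \<bullet> \<Gamma>' i)" "\<Gamma> i \<bullet> \<Gamma>' i \<in> {-1..1}"
  using inner_bounds_unit[of "\<Gamma> i" "\<Gamma>' i"] configs_norm assms by (auto intro: arccos_lbound)

lemma config_dist_less_iff:
  assumes "n \<ge> 1"
  shows "config_dist n \<Gamma> \<Gamma>' < e \<longleftrightarrow> (\<forall>i\<in>{1..n}. arccos (\<Gamma> i \<bullet> \<Gamma>' i) < e)"
  unfolding config_dist_def using assms by (subst Max_less_iff) auto

lemma config_dist_ge:
  assumes "i \<in> {1..n}"
  shows "arccos (\<Gamma> i \<bullet> \<Gamma>' i) \<le> config_dist n \<Gamma> \<Gamma>'"
  unfolding config_dist_def using assms by (intro Max_ge) auto

lemma config_dist_nonneg: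
  assumes "n \<ge> 1" "\<Gamma> \<in> configs n" "\<Gamma>' \<in> configs n"
  shows "0 \<le> config_dist n \<Gamma> \<Gamma>'"
  using angle_bounds(1)[OF assms(2,3), of 1] config_dist_ge[of 1 n \<Gamma> \<Gamma>'] assms(1) by simp

lemma config_setdist_bdd:
  assumes "n \<ge> 1" "\<Gamma> \<in> configs n" "M \<subseteq> configs n"
  shows "bdd_below (config_dist n \<Gamma> ` M)"
  using config_dist_nonneg[OF assms(1,2)] assms(3) by (intro bdd_belowI2[of _ 0]) auto

lemma config_setdist_le:
  assumes "n \<ge> 1" "\<Gamma> \<in> configs n" "M \<subseteq> configs n" "m \<in> M"
  shows "config_setdist n M \<Gamma> \<le> config_dist n \<Gamma> m"
  unfolding config_setdist_def using config_setdist_bdd[OF assms(1-3)] assms(4) by (rule cINF_lower)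

lemma config_setdist_less_iff:
  assumes "n \<ge> 1" "\<Gamma> \<in> configs n" "M \<subseteq> configs n" "M \<noteq> {}"
  shows "config_setdist n M \<Gamma> < e \<longleftrightarrow> (\<exists>m\<in>M. config_dist n \<Gamma> m < e)"
  unfolding config_setdist_def by (rule cINF_less_iff[OF assms(4) config_setdist_bdd[OF assms(1-3)]])

lemma config_setdist_nonneg:
  assumes "n \<ge> 1" "\<Gamma> \<in> configs n" "M \<subseteq> configs n" "M \<noteq> {}"
  shows "0 \<le> config_setdist n M \<Gamma>"
  unfolding config_setdist_def
  by (rule cINF_greatest[OF assms(4)]) (use config_dist_nonneg assms in auto)

text \<open>
  Together with \<open>config_setdist_pos_on_disjoint_compact\<close> this replaces continuity of the distance to M: no
  triangle inequality for angles is needed, since each point of M contributes a closed condition.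
\<close>

lemma closed_config_setdist_ge:
  assumes n: "n \<ge> 1" and M: "M \<subseteq> configs n" "M \<noteq> {}"
  shows "closed {\<Gamma> \<in> configs n. e \<le> config_setdist n M \<Gamma>}"
proof -
  have "e \<le> config_setdist n M \<Gamma> \<longleftrightarrow> (\<forall>m\<in>M. \<exists>i\<in>{1..n}. arccos (\<Gamma> i \<bullet> m i) \<in> {e..})"
    if "\<Gamma> \<in> configs n" for \<Gamma>
    unfolding not_less[symmetric] config_setdist_less_iff[OF n that M] config_dist_less_iff[OF n]
    by (simp add: not_less)
  then have "{\<Gamma> \<in> configs n. e \<le> config_setdist n M \<Gamma>}
      = (\<Inter>m\<in>M. \<Union>i\<in>{1..n}. {\<Gamma> \<in> configs n. arccos (\<Gamma> i \<bullet> m i) \<in> {e..}})"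
    using M(2) by auto
  moreover have "closed {\<Gamma> \<in> configs n. arccos (\<Gamma> i \<bullet> m i) \<in> {e..}}" if "m \<in> M" "i \<in> {1..n}" for m i
  proof -
    have "continuous_on (configs n) (\<lambda>\<Gamma>. arccos (\<Gamma> i \<bullet> m i))"
      using angle_bounds(2) M that
      by (intro continuous_on_arccos continuous_intros
          continuous_on_subset[OF continuous_on_product_coordinates]) fastforce+
    then have "closed (configs n \<inter> (\<lambda>\<Gamma>. arccos (\<Gamma> i \<bullet> m i)) -` {e..})"
      using closed_configs closed_atLeast by (rule continuous_closed_preimage)
    also have "configs n \<inter> (\<lambda>\<Gamma>. arccos (\<Gamma> i \<bullet> m i)) -` {e..} = {\<Gamma> \<in> configs n. arccos (\<Gamma> i \<bullet> m i) \<in> {e..}}"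
      by auto
    finally show ?thesis .
  qed
  ultimately show ?thesis
    by (simp add: closed_INT closed_UN)
qed

lemma config_dist_self:
  assumes "n \<ge> 1" "\<Gamma> \<in> configs n"
  shows "config_dist n \<Gamma> \<Gamma> = 0"
proof -
  have "(\<lambda>i. arccos (\<Gamma> i \<bullet> \<Gamma> i)) ` {1..n} = (\<lambda>i. 0) ` {1..n}"
    by (rule image_cong) (simp_all add: configs_inner[OF assms(2)])
  then show ?thesis
    using assms(1) by (simp add: config_dist_def)
qed

lemma config_setdist_member:
  assumes "n \<ge> 1" "M \<subseteq> configs n" "\<Gamma> \<in> M"
  shows "config_setdist n M \<Gamma> = 0"
proof (rule antisym)
  have \<Gamma>: "\<Gamma> \<in> configs n" using assms by auto
  show "config_setdist n M \<Gamma> \<le> 0"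
    using config_setdist_le[OF assms(1) \<Gamma> assms(2,3)] config_dist_self[OF assms(1) \<Gamma>] by simp
  show "0 \<le> config_setdist n M \<Gamma>"
    using config_setdist_nonneg[OF assms(1) \<Gamma> assms(2)] assms(3) by auto
qed

text \<open>
  The sum of the angles is continuous on the product of the two compact sets and at most n times the
  maximal angle, so its positive minimum, divided by n, bounds the distance from below.
\<close>

lemma config_setdist_pos_on_disjoint_compact:
  assumes n: "n \<ge> 1" and M: "compact M" "M \<subseteq> configs n" "M \<noteq> {}"
    and K: "compact K" "K \<subseteq> configs n" "K \<inter> M = {}"
  obtains e where "e > 0" "\<And>\<Gamma>. \<Gamma> \<in> K \<Longrightarrow> e \<le> config_setdist n M \<Gamma>"
proof (cases "K = {}")
  case True
  then show ?thesis using that[of 1] by auto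
next
  case False
  define S where "S = (\<lambda>p::(nat \<Rightarrow> real^3) \<times> (nat \<Rightarrow> real^3). \<Sum>i=1..n. arccos (fst p i \<bullet> snd p i))"
  have cfst: "continuous_on A (\<lambda>p. fst p i)" and csnd: "continuous_on A (\<lambda>p. snd p i)"
    for i :: nat and A :: "((nat \<Rightarrow> real^3) \<times> (nat \<Rightarrow> real^3)) set"
    by (rule continuous_on_product_then_coordinatewise, intro continuous_intros)+
  have "continuous_on (K \<times> M) S"
    unfolding S_def
  proof (intro continuous_on_sum continuous_on_arccos continuous_on_inner cfst csnd ballI)
    fix i p assume "i \<in> {1..n}" "p \<in> K \<times> M"
    then have "fst p i \<bullet> snd p i \<in> {-1..1}"
      using K(2) M(2) by (intro angle_bounds(2)) auto
    then show "-1 \<le> fst p i \<bullet> snd p i \<and> fst p i \<bullet> snd p i \<le> 1" by simp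
  qed
  then obtain p where p: "p \<in> K \<times> M" and min: "\<And>q. q \<in> K \<times> M \<Longrightarrow> S p \<le> S q"
    using continuous_attains_inf[of "K \<times> M" S] compact_Times[OF K(1) M(1)] False M(3) by auto
  obtain a b where ab: "p = (a, b)" by (cases p)
  have a: "a \<in> configs n" and b: "b \<in> configs n" and neq: "a \<noteq> b"
    using p K M by (auto simp: ab)
  obtain j where j: "j \<in> {1..n}" "a j \<noteq> b j"
    using neq a b unfolding configs_def by (meson PiE_ext)
  have "arccos (a j \<bullet> b j) \<noteq> 0"
  proof
    assume "arccos (a j \<bullet> b j) = 0"
    then have "a j \<bullet> b j = 1"
      using angle_bounds(2)[OF a b j(1)] by (simp only: arccos_eq_0_iff)
    then have "(a j - b j) \<bullet> (a j - b j) = 0"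
      using configs_inner[OF a j(1)] configs_inner[OF b j(1)]
      by (simp add: inner_diff_left inner_diff_right inner_commute)
    then show False using j by simp
  qed
  then have "0 < arccos (a j \<bullet> b j)"
    using angle_bounds(1)[OF a b j(1)] by simp
  also have "\<dots> \<le> S p"
    unfolding S_def ab fst_conv snd_conv
    by (rule member_le_sum[OF j(1)]) (use angle_bounds(1)[OF a b] in auto)
  finally have pos: "0 < S p" .
  have bound: "S p / n \<le> config_dist n \<Gamma> m" if "\<Gamma> \<in> K" "m \<in> M" for \<Gamma> m
  proof -
    have "S p \<le> S (\<Gamma>, m)" using min that by auto
    also have "\<dots> \<le> (\<Sum>i=1..n. config_dist n \<Gamma> m)"
      unfolding S_def by (intro sum_mono) (simp add: config_dist_ge)
    finally show ?thesis using n by (simp add: field_simps)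
  qed
  show ?thesis
  proof (rule that)
    show "0 < S p / n" using pos n by simp
    show "S p / n \<le> config_setdist n M \<Gamma>" if "\<Gamma> \<in> K" for \<Gamma>
      unfolding config_setdist_def by (rule cINF_greatest[OF M(3)]) (use bound that in auto)
  qed
qed

lemma trajectory_continuous:
  assumes "trajectory n x"
  shows "continuous_on {0..} x"
proof (rule continuous_on_coordinatewise_then_product)
  fix i
  show "continuous_on {0..} (\<lambda>t. x t i)"
  proof (cases "i \<in> {1..n}")
    case True
    then show ?thesis
      using assms unfolding trajectory_def continuous_on_eq_continuous_within
      by (metis has_vector_derivative_continuous atLeast_iff)
  next
    case False
    have "x t i = undefined" if "t \<in> {0..}" for t
      using assms False that unfolding trajectory_def configs_def by (auto simp: PiE_def extensional_def)
    then show ?thesis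
      using continuous_on_const[of "{0..}" undefined] continuous_on_cong[OF refl] by metis
  qed
qed

section \<open>Omega-limit sets in a compact space\<close>

definition omega_limit :: "(real \<Rightarrow> 'a::topological_space) \<Rightarrow> 'a set" where
  "omega_limit x = (\<Inter>k::nat. closure (x ` {real k..}))"

lemma omega_limit_subset_closure: "omega_limit x \<subseteq> closure (x ` {t..})"
proof -
  obtain k :: nat where "t \<le> real k" using real_arch_simple by blast
  then have "closure (x ` {real k..}) \<subseteq> closure (x ` {t..})"
    by (intro closure_mono image_mono) auto
  then show ?thesis unfolding omega_limit_def by blast
qed

text \<open>
  The part of K outside W is covered by the complements of the nested tail closures; beyond the
  largest index of a finite subcover the curve cannot return to that part.
\<close>

lemma omega_limit_attracts:
  fixes x :: "real \<Rightarrow> 'a::t2_space"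
  assumes K: "compact K" "\<And>t. t \<ge> 0 \<Longrightarrow> x t \<in> K" and W: "open W" "omega_limit x \<subseteq> W"
  shows "\<exists>T\<ge>0. \<forall>t\<ge>T. x t \<in> W"
proof -
  have "compact (K - W)" using K(1) W(1) by (rule compact_diff)
  moreover have "open (- closure (x ` {real k..}))" if "k \<in> (UNIV::nat set)" for k
    by (rule open_Compl[OF closed_closure])
  moreover have "K - W \<subseteq> (\<Union>k\<in>UNIV. - closure (x ` {real k..}))"
    using W(2) unfolding omega_limit_def by blast
  ultimately obtain C where C: "C \<subseteq> UNIV" "finite C" "K - W \<subseteq> (\<Union>k\<in>C. - closure (x ` {real k..}))"
    by (rule compactE_image[where f = "\<lambda>k. - closure (x ` {real k..})"])
  define T where "T = real (Max (insert 0 C))"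
  have "x t \<in> W" if "t \<ge> T" for t
  proof (rule ccontr)
    assume "x t \<notin> W"
    moreover have "0 \<le> t" using that by (simp add: T_def)
    ultimately have "x t \<in> K - W" using K(2) by auto
    then obtain k where k: "k \<in> C" "x t \<notin> closure (x ` {real k..})" using C by blast
    have "real k \<le> T" unfolding T_def using k C by (simp add: Max_ge)
    then have "x t \<in> x ` {real k..}" using that by auto
    then show False using k(2) closure_subset[of "x ` {real k..}"] by (meson subsetD)
  qed
  then show ?thesis by (intro exI[of _ T]) (simp add: T_def)
qed

lemma omega_limit_nonempty:
  fixes x :: "real \<Rightarrow> 'a::t2_space"
  assumes "compact K" "\<And>t. t \<ge> 0 \<Longrightarrow> x t \<in> K"
  shows "omega_limit x \<noteq> {}"
proof
  assume "omega_limit x = {}"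
  then have "\<exists>T\<ge>0. \<forall>t\<ge>T. x t \<in> {}"
    by (intro omega_limit_attracts[OF assms]) simp_all
  then show False by auto
qed

text \<open>
  If the limit set split into two closed pieces, the open sets of points closer to the one or to the other
  would separate it; a tail of the curve lies in their union and is connected, so it misses one of
  them, whereas both contain limit points.
\<close>

lemma omega_limit_connected:
  fixes x :: "real \<Rightarrow> 'a::metric_space"
  assumes K: "compact K" "\<And>t. t \<ge> 0 \<Longrightarrow> x t \<in> K" and x: "continuous_on {0..} x"
  shows "connected (omega_limit x)"
proof (rule ccontr)
  assume "\<not> connected (omega_limit x)"
  then obtain A0 B0 where AB0: "closed A0" "closed B0" "omega_limit x \<subseteq> A0 \<union> B0"
    "A0 \<inter> B0 \<inter> omega_limit x = {}" "A0 \<inter> omega_limit x \<noteq> {}" "B0 \<inter> omega_limit x \<noteq> {}"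
    unfolding connected_closed by metis
  define A where "A = A0 \<inter> omega_limit x"
  define B where "B = B0 \<inter> omega_limit x"
  have "closed (omega_limit x)"
    unfolding omega_limit_def by (simp add: closed_INT)
  then have AB: "closed A" "closed B" "A \<noteq> {}" "B \<noteq> {}" "A \<union> B = omega_limit x" "A \<inter> B = {}"
    using AB0 unfolding A_def B_def by blast+
  define U where "U = {y. infdist y A < infdist y B}"
  define V where "V = {y. infdist y B < infdist y A}"
  have op: "open U" "open V"
    unfolding U_def V_def by (intro open_Collect_less continuous_on_infdist continuous_on_id)+
  have zero: "infdist y A = 0 \<longleftrightarrow> y \<in> A" "infdist y B = 0 \<longleftrightarrow> y \<in> B" for y
    using AB by (simp_all add: in_closed_iff_infdist_zero)
  have sub: "A \<subseteq> U" "B \<subseteq> V"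
  proof -
    show "A \<subseteq> U"
    proof
      fix y assume "y \<in> A"
      then have "infdist y A = 0" "infdist y B \<noteq> 0" using AB(6) zero by auto
      then show "y \<in> U" using infdist_nonneg[of y B] by (simp add: U_def)
    qed
    show "B \<subseteq> V"
    proof
      fix y assume "y \<in> B"
      then have "infdist y B = 0" "infdist y A \<noteq> 0" using AB(6) zero by auto
      then show "y \<in> V" using infdist_nonneg[of y A] by (simp add: V_def)
    qed
  qed
  have "open (U \<union> V)" "omega_limit x \<subseteq> U \<union> V" using op sub AB by auto
  then obtain T where T: "T \<ge> 0" "\<And>t. t \<ge> T \<Longrightarrow> x t \<in> U \<union> V"
    using omega_limit_attracts[OF K(1), of x "U \<union> V"] K(2) by blast
  have "connected (x ` {T..})"
    by (intro connected_continuous_image continuous_on_subset[OF x]) (use T in auto)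
  moreover have "U \<inter> V = {}" by (auto simp: U_def V_def)
  ultimately have "U \<inter> x ` {T..} = {} \<or> V \<inter> x ` {T..} = {}"
    using op T(2) by (intro connectedD) auto
  moreover have "U \<inter> closure (x ` {T..}) \<noteq> {}" "V \<inter> closure (x ` {T..}) \<noteq> {}"
    using AB(3-5) sub omega_limit_subset_closure[of x T] by fast+
  ultimately show False
    using op by (simp add: open_Int_closure_eq_empty)
qed

section \<open>Convergence to an equilibrium manifold\<close>

lemma norm_cross_le: "norm (cross3 x y) \<le> norm x * norm y"
proof (rule power2_le_imp_le)
  show "(norm (cross3 x y))\<^sup>2 \<le> (norm x * norm y)\<^sup>2"
    using norm_cross_dot[of x y] zero_le_power2[of "x \<bullet> y"] by linarith
qed simp

lemma norm_cross_le_bounds: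
  assumes "norm x \<le> a" "norm y \<le> b" "0 \<le> a"
  shows "norm (cross3 x y) \<le> a * b"
  using norm_cross_le[of x y] mult_mono[OF assms(1,2,3) norm_ge_zero] by linarith

text \<open>
  The constant 6 counts two changes of a factor u against \<open>norm s \<le> 2\<close> and one change of s.
\<close>

lemma cross_cross_lipschitz:
  assumes "norm u \<le> 1" "norm u' \<le> 1" "norm s \<le> 2"
    and "norm (u - u') \<le> d" "norm (s - s') \<le> 2 * d"
  shows "norm (cross3 u (cross3 u s) - cross3 u' (cross3 u' s')) \<le> 6 * d"
proof -
  have "cross3 u (cross3 u s) - cross3 u' (cross3 u' s')
      = cross3 (u - u') (cross3 u s) + cross3 u' (cross3 (u - u') s) + cross3 u' (cross3 u' (s - s'))"
    by (simp add: Cross3.left_diff_distrib Cross3.right_diff_distrib)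
  moreover have "norm (cross3 (u - u') (cross3 u s)) \<le> d * (1 * 2)"
    using assms by (intro norm_cross_le_bounds) (auto intro: order_trans[OF norm_ge_zero])
  moreover have "norm (cross3 u' (cross3 (u - u') s)) \<le> 1 * (d * 2)"
    using assms by (intro norm_cross_le_bounds) (auto intro: order_trans[OF norm_ge_zero])
  moreover have "norm (cross3 u' (cross3 u' (s - s'))) \<le> 1 * (1 * (2 * d))"
    using assms by (intro norm_cross_le_bounds) auto
  ultimately show ?thesis
    using norm_triangle_ineq[of "cross3 (u - u') (cross3 u s) + cross3 u' (cross3 (u - u') s)"
        "cross3 u' (cross3 u' (s - s'))"]
      norm_triangle_ineq[of "cross3 (u - u') (cross3 u s)" "cross3 u' (cross3 (u - u') s)"]
    by simp
qed

lemma ring_nbrs_subset: "i \<in> {1..n} \<Longrightarrow> ring_nbrs n i \<subseteq> {1..n}"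
  by (auto simp: ring_nbrs_def)

lemma norm_sum_ring_nbrs:
  assumes "i \<in> {1..n}" "\<And>j. j \<in> {1..n} \<Longrightarrow> norm (a j :: 'a::real_normed_vector) \<le> d"
  shows "norm (\<Sum>j\<in>ring_nbrs n i. a j) \<le> 2 * d"
proof -
  have d: "0 \<le> d" using assms(2)[OF assms(1)] norm_ge_zero order_trans by blast
  have "norm (\<Sum>j\<in>ring_nbrs n i. a j) \<le> of_nat (card (ring_nbrs n i)) * d"
    using ring_nbrs_subset[OF assms(1)] assms(2) by (intro sum_norm_bound) auto
  also have "\<dots> \<le> 2 * d"
    using d by (intro mult_right_mono) (auto simp: ring_nbrs_def card_insert_if)
  finally show ?thesis .
qed

lemma ring_field_lipschitz:
  assumes "i \<in> {1..n}" "\<And>j. j \<in> {1..n} \<Longrightarrow> norm (a j) \<le> 1" "\<And>j. j \<in> {1..n} \<Longrightarrow> norm (b j) \<le> 1"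
    and "\<And>j. j \<in> {1..n} \<Longrightarrow> norm (a j - b j) \<le> d"
  shows "norm (ring_field n a i - ring_field n b i) \<le> 6 * d"
  unfolding ring_field_def
proof (rule cross_cross_lipschitz)
  show "norm (sum a (ring_nbrs n i)) \<le> 2"
    using norm_sum_ring_nbrs[OF assms(1), of a 1] assms by simp
  show "norm (sum a (ring_nbrs n i) - sum b (ring_nbrs n i)) \<le> 2 * d"
    using norm_sum_ring_nbrs[OF assms(1), of "\<lambda>j. a j - b j" d] assms
    by (simp add: sum_subtractf)
qed (use assms in auto)

lemma ring_field_bound:
  assumes "i \<in> {1..n}" "\<And>j. j \<in> {1..n} \<Longrightarrow> norm (a j) \<le> 1"
  shows "norm (ring_field n a i) \<le> 2"
proof -
  have "norm (ring_field n a i) \<le> 1 * (1 * (2 * 1))"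
    unfolding ring_field_def using assms
    by (intro norm_cross_le_bounds norm_sum_ring_nbrs) auto
  then show ?thesis by simp
qed

lemma trajectory_at:
  assumes "trajectory n x" "t > 0" "i \<in> {1..n}"
  shows "((\<lambda>s. x s i) has_vector_derivative ring_field n (x t) i) (at t)"
  using assms at_within_interior[of t "{0..}"] unfolding trajectory_def by (metis interior_real_atLeast greaterThan_iff less_imp_le)

lemma trajectory_speed:
  assumes x: "trajectory n x" and i: "i \<in> {1..n}" and st: "0 \<le> s" "s \<le> t"
  shows "norm (x t i - x s i) \<le> 2 * (t - s)"
proof (cases "s = t")
  case False
  have "norm (x t i - x s i) \<le> 2 * t - 2 * s"
  proof (rule differentiable_bound_general[where \<phi>' = "\<lambda>_. 2" and f' = "\<lambda>t. ring_field n (x t) i"])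
    show "s < t" using False st by simp
    show "continuous_on {s..t} (\<lambda>t. x t i)"
      using continuous_on_product_then_coordinatewise[OF trajectory_continuous[OF x]]
      by (rule continuous_on_subset) (use st in auto)
    show "continuous_on {s..t} (\<lambda>t::real. 2 * t)" by (intro continuous_intros)
    fix r assume r: "s < r" "r < t"
    then show "((\<lambda>t. x t i) has_vector_derivative ring_field n (x r) i) (at r)"
      using trajectory_at[OF x _ i] st by simp
    show "((*) 2 has_vector_derivative 2) (at r)"
      by (auto intro!: derivative_eq_intros simp: has_real_derivative_iff_has_vector_derivative[symmetric])
    have "x r \<in> configs n" using x r st by (simp add: trajectory_def)
    then show "norm (ring_field n (x r) i) \<le> 2"
      using i configs_norm by (intro ring_field_bound) auto
  qed
  then show ?thesis by simp
qed simp

lemma energy_lower: 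
  assumes "\<Gamma> \<in> configs n" shows "- real n \<le> energy n \<Gamma>"
proof -
  have "(\<Sum>i=1..n. -1) \<le> energy n \<Gamma>"
    unfolding energy_def
    by (intro sum_mono inner_bounds_unit configs_norm[OF assms] ring_succ_in)
  then show ?thesis by simp
qed

text \<open>
  Speeds are at most 2 and the field has Lipschitz constant 6, so during the time \<open>e / 24\<close> a velocity
  of size e can lose at most half of its size, and the energy falls by a definite amount.
\<close>

lemma energy_drop:
  assumes n: "n \<ge> 2" and x: "trajectory n x" and i: "i \<in> {1..n}" and t: "t > 0"
    and e: "e > 0" "e \<le> norm (ring_field n (x t) i)"
  shows "energy n (x (t + e / 24)) \<le> energy n (x t) - e / 24 * (e / 2)\<^sup>2"
proof -
  define \<tau> where "\<tau> = e / 24"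
  have \<tau>: "\<tau> > 0" using e by (simp add: \<tau>_def)
  let ?D = "\<lambda>r. - (\<Sum>i=1..n. (norm (ring_field n (x r) i))\<^sup>2) / coupling n"
  have "((\<lambda>s. energy n (x s)) has_real_derivative ?D r) (at r)" if "t \<le> r" for r
    using energy_has_derivative[OF n x, of r] at_within_interior[of r "{0..}"] that t by simp
  then obtain z where z: "t < z" "z < t + \<tau>"
    and eq: "energy n (x (t + \<tau>)) - energy n (x t) = (t + \<tau> - t) * ?D z"
    using MVT2[of t "t + \<tau>" "\<lambda>s. energy n (x s)" ?D] \<tau> by auto
  have cf: "x t \<in> configs n" "x z \<in> configs n" using x z t by (auto simp: trajectory_def)
  have "norm (ring_field n (x t) i - ring_field n (x z) i) \<le> 6 * (2 * \<tau>)"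
  proof (rule ring_field_lipschitz[OF i])
    fix j assume j: "j \<in> {1..n}"
    show "norm (x t j) \<le> 1" "norm (x z j) \<le> 1" using configs_norm j cf by auto
    show "norm (x t j - x z j) \<le> 2 * \<tau>"
      using trajectory_speed[OF x j, of t z] z t by (simp add: norm_minus_commute)
  qed
  then have "e / 2 \<le> norm (ring_field n (x z) i)"
    using e norm_triangle_ineq2[of "ring_field n (x t) i" "ring_field n (x z) i"] by (simp add: \<tau>_def)
  then have "(e / 2)\<^sup>2 \<le> (norm (ring_field n (x z) i))\<^sup>2"
    using e by (intro power_mono) auto
  also have "\<dots> \<le> (\<Sum>i=1..n. (norm (ring_field n (x z) i))\<^sup>2)"
    by (rule member_le_sum[OF i]) auto
  also have "\<dots> \<le> (\<Sum>i=1..n. (norm (ring_field n (x z) i))\<^sup>2) / coupling n"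
    using coupling_pos[of n] coupling_le_1[of n]
    by (simp add: pos_le_divide_eq mult_left_le sum_nonneg)
  finally have "\<tau> * (e / 2)\<^sup>2 \<le> \<tau> * ((\<Sum>i=1..n. (norm (ring_field n (x z) i))\<^sup>2) / coupling n)"
    using \<tau> by (intro mult_left_mono) auto
  then show ?thesis
    using eq unfolding \<tau>_def[symmetric] by simp
qed

text \<open>
  A speed of size e at arbitrarily late times would take the energy below its infimum.
\<close>

lemma ring_field_vanishes:
  assumes n: "n \<ge> 2" and x: "trajectory n x" and i: "i \<in> {1..n}" and e: "e > 0"
  shows "\<exists>T. \<forall>t\<ge>T. norm (ring_field n (x t) i) < e"
proof -
  let ?E = "\<lambda>t. energy n (x t)"
  define L where "L = (INF t\<in>{0<..}. ?E t)"
  have bdd: "bdd_below (?E ` {0<..})"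
    using energy_lower x by (intro bdd_belowI2[of _ "- real n"]) (auto simp: trajectory_def)
  define d where "d = e / 24 * (e / 2)\<^sup>2"
  have "d > 0" using e by (simp add: d_def)
  then have "L < L + d" by simp
  then have "\<exists>t\<in>{0<..}. ?E t < L + d"
    unfolding L_def by (subst (asm) cINF_less_iff[OF _ bdd]) simp_all
  then obtain T where T: "T > 0" "?E T < L + d"
    by auto
  have "norm (ring_field n (x t) i) < e" if t: "t \<ge> T" for t
  proof (rule ccontr)
    assume "\<not> norm (ring_field n (x t) i) < e"
    then have "?E (t + e / 24) \<le> ?E t - d"
      unfolding d_def using t T e by (intro energy_drop[OF n x i]) auto
    also have "\<dots> \<le> ?E T - d"
      using energy_antimono[OF n x, of T t] t T by simp
    also have "\<dots> < L" using T by simp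
    also have "\<dots> \<le> ?E (t + e / 24)"
      unfolding L_def using t T e by (intro cINF_lower[OF bdd]) simp
    finally show False by simp
  qed
  then show ?thesis by blast
qed

lemma trajectory_in_configs: "trajectory n x \<Longrightarrow> t \<ge> 0 \<Longrightarrow> x t \<in> configs n"
  by (simp add: trajectory_def)

lemma omega_limit_equilibria:
  assumes n: "n \<ge> 2" and x: "trajectory n x"
  shows "omega_limit x \<subseteq> equilibria n"
proof
  fix q assume q: "q \<in> omega_limit x"
  have "x ` {0..} \<subseteq> configs n"
    using trajectory_in_configs[OF x] by auto
  then have "closure (x ` {0..}) \<subseteq> configs n"
    by (rule closure_minimal[OF _ closed_configs])
  then have "q \<in> configs n"
    using q omega_limit_subset_closure[of x 0] by (meson subsetD)
  moreover have "ring_field n q i = 0" if i: "i \<in> {1..n}" for i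
  proof -
    have "norm (ring_field n q i) \<le> e" if e: "e > 0" for e
    proof -
      obtain T where T: "\<And>t. t \<ge> T \<Longrightarrow> norm (ring_field n (x t) i) < e"
        using ring_field_vanishes[OF n x i e] by blast
      have "closed {\<Gamma>. norm (ring_field n \<Gamma> i) \<le> e}"
        by (intro closed_Collect_le continuous_on_norm continuous_on_ring_field continuous_on_const)
      moreover have "x ` {T..} \<subseteq> {\<Gamma>. norm (ring_field n \<Gamma> i) \<le> e}"
        using T by (auto intro: less_imp_le)
      ultimately have "closure (x ` {T..}) \<subseteq> {\<Gamma>. norm (ring_field n \<Gamma> i) \<le> e}"
        by (rule closure_minimal[rotated])
      then show ?thesis
        using q omega_limit_subset_closure[of x T] by auto
    qed
    then have "norm (ring_field n q i) \<le> 0"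
      by (rule field_le_epsilon[of _ 0, simplified])
    then show ?thesis by simp
  qed
  ultimately show "q \<in> equilibria n"
    by (simp add: equilibria_def)
qed

lemma trajectory_omega_limit:
  assumes x: "trajectory n x"
  shows "omega_limit x \<noteq> {}" "connected (omega_limit x)"
  using omega_limit_nonempty[OF compact_configs trajectory_in_configs[OF x]]
    omega_limit_connected[OF compact_configs trajectory_in_configs[OF x] trajectory_continuous[OF x]]
  by auto

theorem trajectory_approaches_equilibrium_manifold:
  assumes n: "n \<ge> 2" and x: "trajectory n x"
  shows "\<exists>M\<in>equilibrium_manifolds n. approaches n x M"
proof -
  have "equilibria n \<noteq> {}"
    using omega_limit_equilibria[OF n x] trajectory_omega_limit(1)[OF x] by auto
  then obtain M where M: "M \<in> equilibrium_manifolds n" and sub: "omega_limit x \<subseteq> M"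
    unfolding equilibrium_manifolds_def
    using exists_component_superset[OF omega_limit_equilibria[OF n x] _ trajectory_omega_limit(2)[OF x]]
    by blast
  note MP = equilibrium_manifold_props[OF M]
  have n1: "n \<ge> 1" using n by simp
  have "approaches n x M"
    unfolding approaches_def
  proof (rule tendstoI)
    fix e :: real assume e: "e > 0"
    let ?F = "{\<Gamma> \<in> configs n. e \<le> config_setdist n M \<Gamma>}"
    have "omega_limit x \<subseteq> - ?F"
      using sub e config_setdist_member[OF n1 MP(3)] by force
    moreover have "open (- ?F)"
      by (rule open_Compl[OF closed_config_setdist_ge[OF n1 MP(3) MP(2)]])
    ultimately have "\<exists>T\<ge>0. \<forall>t\<ge>T. x t \<in> - ?F"
      using trajectory_in_configs[OF x] by (intro omega_limit_attracts[OF compact_configs]) simp_all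
    then obtain T where T: "T \<ge> 0" "\<And>t. t \<ge> T \<Longrightarrow> x t \<in> - ?F"
      by blast
    have "dist (config_setdist n M (x t)) 0 < e" if "t \<ge> T" for t
      using T(2)[OF that] trajectory_in_configs[OF x, of t] T(1) that
        config_setdist_nonneg[OF n1 _ MP(3) MP(2), of "x t"] by auto
    then show "\<forall>\<^sub>F t in at_top. dist (config_setdist n M (x t)) 0 < e"
      unfolding eventually_at_top_linorder by blast
  qed
  then show ?thesis using M by blast
qed

text \<open>
  An omega-limit point serves: its energy is the limit of the decreasing energy.
\<close>

lemma energy_limit:
  assumes n: "n \<ge> 2" and x: "trajectory n x"
  obtains q where "q \<in> equilibria n" "energy n q \<le> energy n (x 0)"
    "\<And>v. energy n q < v \<Longrightarrow> \<exists>t\<ge>0. energy n (x t) < v"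
proof -
  obtain q where q: "q \<in> omega_limit x"
    using trajectory_omega_limit(1)[OF x] by auto
  have "closed {\<Gamma>. energy n \<Gamma> \<le> energy n (x 0)}"
    by (intro closed_Collect_le continuous_on_energy continuous_on_const)
  moreover have "x ` {0..} \<subseteq> {\<Gamma>. energy n \<Gamma> \<le> energy n (x 0)}"
    using energy_antimono[OF n x, of 0] by auto
  ultimately have "closure (x ` {0..}) \<subseteq> {\<Gamma>. energy n \<Gamma> \<le> energy n (x 0)}"
    by (rule closure_minimal[rotated])
  then have le: "energy n q \<le> energy n (x 0)"
    using q omega_limit_subset_closure[of x 0] by auto
  have "\<exists>t\<ge>0. energy n (x t) < v" if "energy n q < v" for v
  proof -
    have "open {\<Gamma>. energy n \<Gamma> < v}"
      by (intro open_Collect_less continuous_on_energy continuous_on_const)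
    moreover have "q \<in> closure (x ` {0..})"
      using q omega_limit_subset_closure[of x 0] by auto
    ultimately have "{\<Gamma>. energy n \<Gamma> < v} \<inter> x ` {0..} \<noteq> {}"
      using that open_Int_closure_eq_empty[of "{\<Gamma>. energy n \<Gamma> < v}" "x ` {0..}"] by auto
    then show ?thesis by auto
  qed
  with q le show ?thesis using that omega_limit_equilibria[OF n x] by blast
qed

section \<open>Finitely many equilibrium energies\<close>

text \<open>
  The ring read as an n-periodic sequence, so that walking around it is induction on a natural number.
\<close>

definition unrolled :: "nat \<Rightarrow> (nat \<Rightarrow> 'a) \<Rightarrow> nat \<Rightarrow> 'a" where
  "unrolled n \<Gamma> k = \<Gamma> (k mod n + 1)"

lemma energy_unrolled: "energy n \<Gamma> = (\<Sum>k<n. unrolled n \<Gamma> k \<bullet> unrolled n \<Gamma> (Suc k))"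
proof -
  have "energy n \<Gamma> = (\<Sum>k<n. \<Gamma> (Suc k) \<bullet> \<Gamma> (ring_succ n (Suc k)))"
    unfolding energy_def by (simp add: sum.atLeast1_atMost_eq)
  also have "\<dots> = (\<Sum>k<n. unrolled n \<Gamma> k \<bullet> unrolled n \<Gamma> (Suc k))"
    by (rule sum.cong) (auto simp: unrolled_def ring_succ_def mod_Suc)
  finally show ?thesis .
qed

lemma unrolled_norm:
  assumes "n \<ge> 1" "\<Gamma> \<in> configs n" shows "norm (unrolled n \<Gamma> k) = 1"
  unfolding unrolled_def using assms by (intro configs_norm) (auto simp: Suc_le_eq)

text \<open>
  At an equilibrium the sum of the two neighbours is \<open>l\<close> times the vector in the middle. Taking norms in
  \<open>G (k + 2) = l G (k + 1) - G k\<close> leaves only the two roots of a quadratic equation in \<open>l\<close>.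
\<close>

lemma equilibrium_next:
  assumes n: "n \<ge> 2" and \<Gamma>: "\<Gamma> \<in> equilibria n"
  defines "G \<equiv> unrolled n \<Gamma>"
  shows "G (Suc (Suc k)) = - G k \<or>
    G (Suc (Suc k)) = (2 * (G (Suc k) \<bullet> G k)) *\<^sub>R G (Suc k) - G k"
proof -
  define i where "i = Suc k mod n + 1"
  have i: "i \<in> {1..n}" using n by (auto simp: i_def Suc_le_eq)
  have sc: "ring_succ n i = Suc (Suc k) mod n + 1" "ring_pred n i = k mod n + 1"
    using n by (auto simp: i_def ring_succ_def ring_pred_def mod_Suc)
  have cf: "\<Gamma> \<in> configs n" and f0: "ring_field n \<Gamma> i = 0"
    using \<Gamma> i by (auto simp: equilibria_def)
  define h where "h = G k + G (Suc (Suc k))"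
  define c where "c = G (Suc k) \<bullet> G k"
  define l where "l = G (Suc k) \<bullet> h"
  have h: "h = l *\<^sub>R G (Suc k)"
    using f0 coupling_pos[of n] unfolding ring_field_eq[OF n cf i] sc
    by (simp add: h_def l_def G_def unrolled_def i_def)
  have unit: "G j \<bullet> G j = 1" for j
    using unrolled_norm[OF _ cf, of j] n by (simp add: G_def norm_eq_1)
  have eq: "G (Suc (Suc k)) = l *\<^sub>R G (Suc k) - G k"
    using h by (simp add: h_def algebra_simps)
  have "1 = (l *\<^sub>R G (Suc k) - G k) \<bullet> (l *\<^sub>R G (Suc k) - G k)"
    using unit[of "Suc (Suc k)"] unfolding eq by simp
  also have "\<dots> = l * l - 2 * l * c + 1"
    by (simp add: inner_diff_left inner_diff_right unit c_def inner_commute)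
  finally have "l * (l - 2 * c) = 0" by algebra
  \<comment> \<open>The root 0 gives the opposite vector, the other root the reflection.\<close>
  then have "l = 0 \<or> l = 2 * c" by (simp only: mult_eq_0_iff right_minus_eq)
  then show ?thesis
    using eq by (auto simp: c_def)
qed

text \<open>
  If v is parallel to u, any unit vector orthogonal to u will do; this case is the reason for the bound on the
  dimension. Otherwise e is the normalised component of v orthogonal to u.
\<close>

lemma orthonormal_completion:
  fixes u v :: "'a::euclidean_space"
  assumes "2 \<le> DIM('a)" "norm u = 1"
  obtains e where "norm e = 1" "e \<bullet> u = 0" "v = (v \<bullet> u) *\<^sub>R u + (v \<bullet> e) *\<^sub>R e"
proof (cases "v - (v \<bullet> u) *\<^sub>R u = 0")
  case True
  obtain y where y: "y \<noteq> 0" "orthogonal u y"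
    using orthogonal_to_vector_exists[OF assms(1)] by blast
  define e where "e = y /\<^sub>R norm y"
  have "norm e = 1" "e \<bullet> u = 0"
    using y by (auto simp: e_def orthogonal_def inner_commute)
  moreover have "v = (v \<bullet> u) *\<^sub>R u" using True by simp
  moreover have "v \<bullet> e = 0"
    using calculation(2,3) by (metis inner_commute inner_scaleR_right mult_zero_right)
  ultimately show ?thesis using that[of e] by simp
next
  case False
  define d where "d = v - (v \<bullet> u) *\<^sub>R u"
  define e where "e = d /\<^sub>R norm d"
  have d: "norm d \<noteq> 0" using False by (simp add: d_def)
  have uu: "u \<bullet> u = 1" using assms(2) by (simp add: norm_eq_1)
  have du: "d \<bullet> u = 0" by (simp add: d_def inner_diff_left uu)
  have "v \<bullet> d = d \<bullet> d"
    using du by (simp add: d_def inner_diff_left inner_diff_right inner_commute uu)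
  then have "(v \<bullet> e) *\<^sub>R e = d"
    using d by (simp add: e_def power2_norm_eq_inner[symmetric] power2_eq_square field_simps)
  moreover have "norm e = 1" "e \<bullet> u = 0" using d du by (auto simp: e_def)
  ultimately show ?thesis using that[of e] by (simp add: d_def)
qed

text \<open>
  The isometric copy of the complex plane spanned by the orthonormal vectors u and e.
\<close>

definition plane_embed :: "'a::real_inner \<Rightarrow> 'a \<Rightarrow> complex \<Rightarrow> 'a" where
  "plane_embed u e z = Re z *\<^sub>R u + Im z *\<^sub>R e"

lemma plane_embed_minus: "plane_embed u e (- z) = - plane_embed u e z"
  by (simp add: plane_embed_def)

lemma plane_embed_reflect:
  "plane_embed u e (of_real r * z - z') = r *\<^sub>R plane_embed u e z - plane_embed u e z'"
  by (simp add: plane_embed_def algebra_simps)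

lemma plane_embed_inner:
  assumes "norm u = 1" "norm e = 1" "e \<bullet> u = 0"
  shows "plane_embed u e z \<bullet> plane_embed u e z' = Re (z * cnj z')"
  using assms by (simp add: plane_embed_def inner_add_left inner_add_right inner_commute[of u e] norm_eq_1)

lemma plane_embed_inj:
  assumes "norm u = 1" "norm e = 1" "e \<bullet> u = 0" "plane_embed u e z = plane_embed u e z'"
  shows "z = z'"
proof -
  have "plane_embed u e z \<bullet> u = Re z" "plane_embed u e z \<bullet> e = Im z" for z
    using assms(1-3) by (simp_all add: plane_embed_def inner_add_left inner_commute[of u e] norm_eq_1)
  then show ?thesis using assms(4) by (metis complex_eqI)
qed

text \<open>
  In the plane of the first two agents the walk multiplies at each step by \<open>w\<close> or \<open>- cnj w\<close>: a
  reflection repeats the previous factor d, whereas passing to the opposite vector replaces d by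
  \<open>- cnj d\<close>, because \<open>d * cnj d = 1\<close>. The numbers a and b count the factors of either kind; the cosine of
  an edge is \<open>Re w\<close> for the first kind and \<open>- Re w\<close> for the second.
\<close>

lemma equilibrium_energy:
  assumes n: "n \<ge> 2" and \<Gamma>: "\<Gamma> \<in> equilibria n"
  obtains a b :: nat and w :: complex
  where "a + b = n" "cmod w = 1" "w ^ a * (- cnj w) ^ b = 1" "energy n \<Gamma> = (real a - real b) * Re w"
proof -
  define G where "G = unrolled n \<Gamma>"
  have cf: "\<Gamma> \<in> configs n" using \<Gamma> by (simp add: equilibria_def)
  have unit: "norm (G k) = 1" for k unfolding G_def using n by (intro unrolled_norm cf) auto
  have "2 \<le> DIM(real^3)" by simp
  then obtain e where e: "norm e = 1" "e \<bullet> G 0 = 0" "G 1 = (G 1 \<bullet> G 0) *\<^sub>R G 0 + (G 1 \<bullet> e) *\<^sub>R e"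
    by (rule orthonormal_completion[OF _ unit[of 0], of "G 1"])
  define \<phi> where "\<phi> = plane_embed (G 0) e"
  define w where "w = Complex (G 1 \<bullet> G 0) (G 1 \<bullet> e)"
  note inner = plane_embed_inner[OF unit[of 0] e(1,2), folded \<phi>_def]
  have G0: "G 0 = \<phi> 1" by (simp add: \<phi>_def plane_embed_def)
  have G1: "G 1 = \<phi> w" using e(3) by (simp add: \<phi>_def plane_embed_def w_def)
  have w1: "w * cnj w = 1"
    using inner[of w w] unit[of 1]
    by (simp add: G1[symmetric] norm_eq_1 complex_eq_iff)
  then have "complex_of_real ((cmod w)\<^sup>2) = of_real 1"
    unfolding complex_norm_square by simp
  then have "(cmod w)\<^sup>2 = 1"
    by (simp only: of_real_eq_iff)
  then have cw: "cmod w = 1"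
    using norm_ge_zero[of w] by (simp add: power2_eq_1_iff)
  have "\<exists>a b d. a + b = k \<and> d \<in> {w, - cnj w} \<and> G k = \<phi> (w ^ a * (- cnj w) ^ b) \<and>
      G (Suc k) = \<phi> (d * (w ^ a * (- cnj w) ^ b)) \<and>
      (\<Sum>j<k. G j \<bullet> G (Suc j)) = (real a - real b) * Re w" for k
  proof (induction k)
    case 0
    then show ?case using G0 G1 by (intro exI[of _ 0] exI[of _ w]) simp
  next
    case (Suc k)
    then obtain a b d where ab: "a + b = k" and d: "d \<in> {w, - cnj w}"
      and Gk: "G k = \<phi> (w ^ a * (- cnj w) ^ b)" and GS: "G (Suc k) = \<phi> (d * (w ^ a * (- cnj w) ^ b))"
      and S: "(\<Sum>j<k. G j \<bullet> G (Suc j)) = (real a - real b) * Re w"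
      by blast
    define z where "z = w ^ a * (- cnj w) ^ b"
    have "cmod z = 1" by (simp add: z_def norm_mult norm_power cw)
    then have zz: "z * cnj z = 1" by (simp add: complex_norm_square[symmetric])
    have dd: "d * cnj d = 1" using d w1 by (auto simp: mult.commute)
    have c: "G (Suc k) \<bullet> G k = Re d"
      using zz by (simp add: GS Gk z_def[symmetric] inner mult.assoc)
    have "\<exists>d'\<in>{w, - cnj w}. G (Suc (Suc k)) = \<phi> (d' * (d * z))"
      using equilibrium_next[OF n \<Gamma>, of k, folded G_def]
    proof
      assume "G (Suc (Suc k)) = - G k"
      also have "\<dots> = \<phi> (- z)" by (simp add: Gk z_def \<phi>_def plane_embed_minus)
      also have "- z = - cnj d * (d * z)" using dd by (simp add: mult.assoc[symmetric] mult.commute)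
      finally show ?thesis using d by (intro bexI[of _ "- cnj d"]) auto
    next
      assume "G (Suc (Suc k)) = (2 * (G (Suc k) \<bullet> G k)) *\<^sub>R G (Suc k) - G k"
      also have "\<dots> = \<phi> (of_real (2 * Re d) * (d * z) - z)"
        unfolding c \<phi>_def plane_embed_reflect by (simp add: GS Gk z_def \<phi>_def)
      also have "of_real (2 * Re d) * (d * z) - z = d * (d * z)"
      proof -
        have "of_real (2 * Re d) * (d * z) - z = (d + cnj d) * (d * z) - z"
          by (simp add: complex_add_cnj)
        also have "\<dots> = d * (d * z) + (d * cnj d) * z - z" by (simp add: algebra_simps)
        finally show ?thesis by (simp add: dd)
      qed
      finally show ?thesis using d by blast
    qed
    then obtain d' where d': "d' \<in> {w, - cnj w}" "G (Suc (Suc k)) = \<phi> (d' * (d * z))" by blast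
    have S': "(\<Sum>j<Suc k. G j \<bullet> G (Suc j)) = (real a - real b) * Re w + Re d"
      using S c by (simp add: inner_commute)
    from d consider "d = w" | "d = - cnj w" by auto
    then show ?case
    proof cases
      case 1
      then have "d * z = w ^ Suc a * (- cnj w) ^ b" by (simp add: z_def)
      then show ?thesis
        using ab d' GS S' 1
        by (intro exI[of _ "Suc a"] exI[of _ b] exI[of _ d']) (simp add: z_def algebra_simps)
    next
      case 2
      then have "d * z = w ^ a * (- cnj w) ^ Suc b" by (simp add: z_def)
      then show ?thesis
        using ab d' GS S' 2
        by (intro exI[of _ a] exI[of _ "Suc b"] exI[of _ d']) (simp add: z_def algebra_simps)
    qed
  qed
  from this[of n] obtain a b where ab: "a + b = n" "G n = \<phi> (w ^ a * (- cnj w) ^ b)"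
    "(\<Sum>j<n. G j \<bullet> G (Suc j)) = (real a - real b) * Re w" by blast
  have "G n = G 0" by (simp add: G_def unrolled_def)
  then have "\<phi> (w ^ a * (- cnj w) ^ b) = \<phi> 1"
    unfolding ab(2) G0 .
  then have "w ^ a * (- cnj w) ^ b = 1"
    unfolding \<phi>_def by (rule plane_embed_inj[OF unit[of 0] e(1,2)])
  moreover have "energy n \<Gamma> = (real a - real b) * Re w"
    using ab(3) energy_unrolled[of n \<Gamma>] by (simp only: G_def)
  ultimately show ?thesis
    by (rule that[OF ab(1) cw])
qed

text \<open>
  Since \<open>w * (- cnj w) = -1\<close>, the closing condition turns into \<open>w ^ a = \<plusminus> w ^ b\<close>. If \<open>a \<noteq> b\<close> then w is a root of
  unity whose order is bounded in terms of n; if \<open>a = b\<close> the energy vanishes whatever w is.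
\<close>

theorem finite_critical_values:
  assumes n: "n \<ge> 2"
  shows "finite (energy n ` equilibria n)"
proof (rule finite_subset)
  let ?V = "\<lambda>a b. (\<lambda>w. (real a - real b) * Re w) ` {w. w ^ (2 * (a - b + (b - a))) = 1}"
  let ?I = "{..n} \<times> {..n} - {(a, b). a = b}"
  show "energy n ` equilibria n \<subseteq> insert 0 (\<Union>(a, b)\<in>?I. ?V a b)"
  proof
    fix v assume "v \<in> energy n ` equilibria n"
    then obtain \<Gamma> where "\<Gamma> \<in> equilibria n" and v: "v = energy n \<Gamma>" by blast
    then obtain a b w where ab: "a + b = n" and w: "cmod w = 1" "w ^ a * (- cnj w) ^ b = 1"
      and E: "energy n \<Gamma> = (real a - real b) * Re w"
      using equilibrium_energy[OF n] by blast
    show "v \<in> insert 0 (\<Union>(a, b)\<in>?I. ?V a b)"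
    proof (cases "a = b")
      case True
      then show ?thesis using v E by simp
    next
      case False
      have wc: "w * cnj w = 1" using w(1) by (simp add: complex_norm_square[symmetric])
      have "w ^ b = w ^ b * (w ^ a * (- cnj w) ^ b)" using w(2) by simp
      also have "\<dots> = w ^ a * (w * (- cnj w)) ^ b" unfolding power_mult_distrib by (simp only: mult_ac)
      also have "\<dots> = w ^ a * (- 1) ^ b" using wc by simp
      finally have "(w ^ b)\<^sup>2 = (w ^ a * (- 1) ^ b)\<^sup>2" by simp
      then have eq: "w ^ (2 * b) = w ^ (2 * a)"
        by (simp add: power_mult_distrib power_mult[symmetric] mult.commute)
      have w0: "w \<noteq> 0" using w(1) by auto
      have "w ^ (2 * (a - b + (b - a))) = 1"
      proof (cases "a \<le> b")
        case True
        then have "w ^ (2 * b) = w ^ (2 * a) * w ^ (2 * (b - a))"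
          by (simp add: power_add[symmetric] algebra_simps)
        then show ?thesis using eq w0 True by simp
      next
        case False
        then have "w ^ (2 * a) = w ^ (2 * b) * w ^ (2 * (a - b))"
          by (simp add: power_add[symmetric] algebra_simps)
        then show ?thesis using eq w0 False by simp
      qed
      then have "v \<in> ?V a b" using v E by blast
      then show ?thesis using ab False by (intro insertI2 UN_I[of "(a, b)"]) auto
    qed
  qed
  have "finite (?V a b)" if "a \<noteq> b" for a b
    by (intro finite_imageI finite_roots_unity) (use that in simp)
  then show "finite (insert 0 (\<Union>(a, b)\<in>?I. ?V a b))"
    by auto
qed

section \<open>Descent at non-alternating configurations\<close>

text \<open>
  The defect is half the square of \<open>sqrt X - sqrt Y\<close>, and multiplying this difference by
  \<open>sqrt X + sqrt Y\<close>, which is at least 1 here, gives \<open>X - Y\<close>.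
\<close>

lemma sqrt_product_am_gm_defect:
  fixes X Y :: real
  assumes "1/2 \<le> X" "1/2 \<le> Y"
  shows "\<bar>(X + Y) / 2 - sqrt X * sqrt Y\<bar> \<le> (X - Y)\<^sup>2 / 2"
proof -
  define a where "a = sqrt X"
  define b where "b = sqrt Y"
  have ab: "a\<^sup>2 = X" "b\<^sup>2 = Y" "0 \<le> a" "0 \<le> b" using assms by (auto simp: a_def b_def)
  have "1 \<le> (a + b)\<^sup>2"
    using ab(1,2) assms mult_nonneg_nonneg[OF ab(3,4)] unfolding power2_sum by linarith
  then have "(a - b)\<^sup>2 * 1 \<le> (a - b)\<^sup>2 * (a + b)\<^sup>2" by (intro mult_left_mono) auto
  also have "\<dots> = ((a - b) * (a + b))\<^sup>2" by (simp add: power_mult_distrib)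
  also have "(a - b) * (a + b) = X - Y"
    unfolding ab(1,2)[symmetric] by (simp add: algebra_simps power2_eq_square)
  finally have "(a - b)\<^sup>2 \<le> (X - Y)\<^sup>2" by simp
  moreover have "(X + Y) / 2 - a * b = (a - b)\<^sup>2 / 2"
    unfolding ab(1,2)[symmetric] by (simp add: power2_diff field_simps)
  moreover have "0 \<le> (a - b)\<^sup>2" by simp
  ultimately show ?thesis unfolding a_def[symmetric] b_def[symmetric] by linarith
qed

text \<open>
  The unit vector x moved by t along the tangential part of u, with the coefficient of x adjusted to stay on
  the sphere. That coefficient depends on t only through its square, so adding the
  values at t and -t removes all odd terms exactly.
\<close>

definition tilt :: "real \<Rightarrow> 'a::real_inner \<Rightarrow> 'a \<Rightarrow> 'a" where
  "tilt t u x = sqrt (1 - t\<^sup>2 * (1 - (u \<bullet> x)\<^sup>2)) *\<^sub>R x + t *\<^sub>R (u - (u \<bullet> x) *\<^sub>R x)"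

lemma tilt_radicand_bounds:
  fixes u x :: "'a::real_inner"
  assumes "norm u = 1" "norm x = 1" "t\<^sup>2 \<le> 1/2"
  shows "0 \<le> 1 - (u \<bullet> x)\<^sup>2" "1/2 \<le> 1 - t\<^sup>2 * (1 - (u \<bullet> x)\<^sup>2)" "t\<^sup>2 * (1 - (u \<bullet> x)\<^sup>2) \<le> t\<^sup>2"
proof -
  have "(u \<bullet> x)\<^sup>2 \<le> 1"
    using inner_bounds_unit(3)[of u x] assms by (simp add: abs_square_le_1)
  then show a: "0 \<le> 1 - (u \<bullet> x)\<^sup>2" by simp
  show b: "t\<^sup>2 * (1 - (u \<bullet> x)\<^sup>2) \<le> t\<^sup>2" by (simp add: mult_left_le)
  then show "1/2 \<le> 1 - t\<^sup>2 * (1 - (u \<bullet> x)\<^sup>2)" using assms(3) by simp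
qed

lemma norm_tilt:
  assumes "norm u = 1" "norm x = 1" "t\<^sup>2 \<le> 1/2"
  shows "norm (tilt t u x) = 1"
proof -
  define a where "a = u \<bullet> x"
  have uu: "u \<bullet> u = 1" "x \<bullet> x = 1" using assms by (auto simp: norm_eq_1)
  have s: "sqrt (1 - t\<^sup>2 * (1 - a\<^sup>2)) * sqrt (1 - t\<^sup>2 * (1 - a\<^sup>2)) = 1 - t\<^sup>2 * (1 - a\<^sup>2)"
    using tilt_radicand_bounds(2)[OF assms] by (simp add: a_def)
  define r where "r = sqrt (1 - t\<^sup>2 * (1 - a\<^sup>2))"
  have "tilt t u x \<bullet> tilt t u x = r * r + t * t * (1 - a * a)"
    unfolding tilt_def a_def[symmetric] r_def[symmetric]
    by (simp add: inner_add_left inner_add_right inner_diff_left inner_diff_right uu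
        inner_commute[of x u] a_def[symmetric] algebra_simps)
  also have "\<dots> = 1" using s by (simp add: r_def power2_eq_square)
  finally show ?thesis by (simp add: norm_eq_1)
qed

lemma inner_tilt_self:
  assumes "norm u = 1" "norm x = 1" "t\<^sup>2 \<le> 1/2"
  shows "1 - t\<^sup>2 \<le> tilt t u x \<bullet> x"
proof -
  have "x \<bullet> x = 1" using assms by (simp add: norm_eq_1)
  then have "tilt t u x \<bullet> x = sqrt (1 - t\<^sup>2 * (1 - (u \<bullet> x)\<^sup>2))"
    by (simp add: tilt_def inner_add_left inner_diff_left)
  moreover have "1 - t\<^sup>2 \<le> sqrt (1 - t\<^sup>2 * (1 - (u \<bullet> x)\<^sup>2))"
  proof (rule order_trans)
    show "1 - t\<^sup>2 \<le> 1 - t\<^sup>2 * (1 - (u \<bullet> x)\<^sup>2)" using tilt_radicand_bounds(3)[OF assms] by simp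
    show "1 - t\<^sup>2 * (1 - (u \<bullet> x)\<^sup>2) \<le> sqrt (1 - t\<^sup>2 * (1 - (u \<bullet> x)\<^sup>2))"
      using tilt_radicand_bounds[OF assms] by (intro real_le_rsqrt) (simp add: power2_eq_square mult_left_le)
  qed
  ultimately show ?thesis by simp
qed

text \<open>
  The radical coming from the two coefficients is replaced by the arithmetic mean of the
  radicands; by \<open>sqrt_product_am_gm_defect\<close> this costs at most a term of order \<open>t ^ 4\<close>.
\<close>

lemma tilt_pair:
  fixes u x y :: "'a::real_inner"
  assumes u: "norm u = 1" and x: "norm x = 1" and y: "norm y = 1" and t: "t\<^sup>2 \<le> 1/2"
  shows "tilt t u x \<bullet> tilt (- t) u y + tilt (- t) u x \<bullet> tilt t u y
    \<le> 2 * (x \<bullet> y) * (1 - t\<^sup>2 + t\<^sup>2 * ((u \<bullet> x)\<^sup>2 + (u \<bullet> y)\<^sup>2) / 2) + t ^ 4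
      - 2 * t\<^sup>2 * (1 - (u \<bullet> x)\<^sup>2 - (u \<bullet> y)\<^sup>2 + (u \<bullet> x) * (u \<bullet> y) * (x \<bullet> y))"
proof -
  define a where "a = u \<bullet> x"
  define b where "b = u \<bullet> y"
  define c where "c = x \<bullet> y"
  define X where "X = 1 - t\<^sup>2 * (1 - a\<^sup>2)"
  define Y where "Y = 1 - t\<^sup>2 * (1 - b\<^sup>2)"
  define m where "m = (X + Y) / 2"
  have uu: "u \<bullet> u = 1" using u by (simp add: norm_eq_1)
  have ic: "x \<bullet> u = a" "y \<bullet> u = b" "y \<bullet> x = c" "u \<bullet> x = a" "u \<bullet> y = b" "x \<bullet> y = c"
    by (simp_all add: a_def b_def c_def inner_commute)
  have eq: "tilt t u x \<bullet> tilt (- t) u y + tilt (- t) u x \<bullet> tilt t u y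
      = 2 * (sqrt X * sqrt Y * c) - 2 * t\<^sup>2 * (1 - a\<^sup>2 - b\<^sup>2 + a * b * c)"
  proof -
    define r where "r = sqrt X"
    define s where "s = sqrt Y"
    show ?thesis
      unfolding tilt_def ic power2_minus X_def[symmetric] Y_def[symmetric] r_def[symmetric] s_def[symmetric]
      by (simp add: inner_add_left inner_add_right inner_diff_left inner_diff_right uu ic
          power2_eq_square algebra_simps)
  qed
  have "\<bar>X - Y\<bar> \<le> t\<^sup>2"
    using tilt_radicand_bounds[OF u x t] tilt_radicand_bounds[OF u y t] unfolding ic X_def Y_def
    using zero_le_power2[of t] mult_nonneg_nonneg[OF zero_le_power2[of t]] by (smt (verit))
  then have "\<bar>X - Y\<bar>\<^sup>2 \<le> (t\<^sup>2)\<^sup>2" by (intro power_mono) auto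
  then have sq: "(X - Y)\<^sup>2 \<le> t ^ 4" by simp
  have "\<bar>m - sqrt X * sqrt Y\<bar> \<le> t ^ 4 / 2"
    using sqrt_product_am_gm_defect[of X Y] tilt_radicand_bounds(2)[OF u x t] tilt_radicand_bounds(2)[OF u y t] sq
    unfolding ic X_def[symmetric] Y_def[symmetric] m_def by linarith
  moreover have "\<bar>c\<bar> \<le> 1" using inner_bounds_unit(3)[of x y] x y by (simp add: c_def)
  ultimately have "\<bar>c\<bar> * \<bar>m - sqrt X * sqrt Y\<bar> \<le> 1 * (t ^ 4 / 2)"
    by (intro mult_mono) auto
  then have "\<bar>c * (m - sqrt X * sqrt Y)\<bar> \<le> t ^ 4 / 2" by (simp add: abs_mult)
  then have "- (c * (m - sqrt X * sqrt Y)) \<le> t ^ 4 / 2" by linarith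
  then have "sqrt X * sqrt Y * c \<le> c * m + t ^ 4 / 2"
    by (simp add: algebra_simps)
  moreover have "m = 1 - t\<^sup>2 + t\<^sup>2 * (a\<^sup>2 + b\<^sup>2) / 2"
    by (simp add: m_def X_def Y_def field_simps)
  ultimately have "sqrt X * sqrt Y * c \<le> c * (1 - t\<^sup>2 + t\<^sup>2 * (a\<^sup>2 + b\<^sup>2) / 2) + t ^ 4 / 2"
    by simp
  then have "2 * (sqrt X * sqrt Y * c) \<le> 2 * c * (1 - t\<^sup>2 + t\<^sup>2 * (a\<^sup>2 + b\<^sup>2) / 2) + t ^ 4"
    by linarith
  then show ?thesis
    unfolding eq ic by linarith
qed

text \<open>
  Summing over an orthonormal basis evaluates the squares of the coordinates to 1 and the mixed products to
  \<open>x \<bullet> y\<close>; the quadratic terms then add up to a negative perfect square. In dimension d the square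
  \<open>(1 + x \<bullet> y)\<^sup>2\<close> would be \<open>(1 + x \<bullet> y) * (d - 2 + x \<bullet> y)\<close>, which for d = 2 can be negative.
\<close>

lemma tilt_pair_sum:
  fixes x y :: "real^3"
  assumes x: "norm x = 1" and y: "norm y = 1" and t: "t\<^sup>2 \<le> 1/2"
  shows "(\<Sum>u\<in>Basis. tilt t u x \<bullet> tilt (- t) u y + tilt (- t) u x \<bullet> tilt t u y)
    \<le> 6 * (x \<bullet> y) - 2 * t\<^sup>2 * (1 + x \<bullet> y)\<^sup>2 + 3 * t ^ 4"
proof -
  define c where "c = x \<bullet> y"
  have sx: "(\<Sum>u\<in>Basis. (u \<bullet> x)\<^sup>2) = 1" and sy: "(\<Sum>u\<in>Basis. (u \<bullet> y)\<^sup>2) = 1"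
    and sc: "(\<Sum>u\<in>Basis. (u \<bullet> x) * (u \<bullet> y)) = c"
    using x y euclidean_inner[of x x] euclidean_inner[of y y] euclidean_inner[of x y]
    by (simp_all add: c_def norm_eq_1 power2_eq_square inner_commute)
  have "(\<Sum>u\<in>Basis. tilt t u x \<bullet> tilt (- t) u y + tilt (- t) u x \<bullet> tilt t u y)
    \<le> (\<Sum>u\<in>Basis. 2 * c * (1 - t\<^sup>2 + t\<^sup>2 * ((u \<bullet> x)\<^sup>2 + (u \<bullet> y)\<^sup>2) / 2) + t ^ 4
      - 2 * t\<^sup>2 * (1 - (u \<bullet> x)\<^sup>2 - (u \<bullet> y)\<^sup>2 + (u \<bullet> x) * (u \<bullet> y) * c))"
    unfolding c_def using x y t by (intro sum_mono tilt_pair) auto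
  also have "\<dots> = (\<Sum>u\<in>(Basis::(real^3) set). 2 * c * (1 - t\<^sup>2) + t ^ 4 - 2 * t\<^sup>2)
      + (c * t\<^sup>2 + 2 * t\<^sup>2) * ((\<Sum>u\<in>Basis. (u \<bullet> x)\<^sup>2) + (\<Sum>u\<in>Basis. (u \<bullet> y)\<^sup>2))
      - 2 * t\<^sup>2 * c * (\<Sum>u\<in>Basis. (u \<bullet> x) * (u \<bullet> y))"
    unfolding sum_distrib_left sum.distrib[symmetric] sum_subtractf[symmetric]
    by (rule sum.cong) (simp_all add: field_simps)
  also have "\<dots> = 6 * c - 2 * t\<^sup>2 * (1 + c)\<^sup>2 + 3 * t ^ 4"
    unfolding sx sy sc by (simp add: power2_eq_square algebra_simps)
  finally show ?thesis by (simp add: c_def)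
qed

definition alternating_tilt :: "nat \<Rightarrow> (nat \<Rightarrow> 'a::real_inner) \<Rightarrow> 'a \<Rightarrow> real \<Rightarrow> nat \<Rightarrow> 'a" where
  "alternating_tilt n \<Gamma> u t = (\<lambda>i\<in>{1..n}. tilt ((-1) ^ i * t) u (\<Gamma> i))"

text \<open>
  The sum of the energies over all six tilted configurations is less than six times the original
  one as soon as t is small, hence one of them has smaller energy.
\<close>

lemma energy_descent_near_nonalternating:
  assumes n: "n \<ge> 2" "even n" and \<Gamma>: "\<Gamma> \<in> configs n"
    and j: "j \<in> {1..n}" "\<Gamma> j \<bullet> \<Gamma> (ring_succ n j) \<noteq> -1" and r: "r > 0"
  obtains \<Gamma>' where "\<Gamma>' \<in> configs n" "\<And>i. i \<in> {1..n} \<Longrightarrow> 1 - r \<le> \<Gamma>' i \<bullet> \<Gamma> i" "energy n \<Gamma>' < energy n \<Gamma>"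
proof -
  define Q where "Q = (\<Sum>i=1..n. (1 + \<Gamma> i \<bullet> \<Gamma> (ring_succ n i))\<^sup>2)"
  have "0 < (1 + \<Gamma> j \<bullet> \<Gamma> (ring_succ n j))\<^sup>2" using j(2) by auto
  also have "\<dots> \<le> Q" unfolding Q_def by (rule member_le_sum[OF j(1)]) auto
  finally have Q: "Q > 0" .
  \<comment> \<open>The last bound makes the quartic error smaller than the quadratic gain.\<close>
  define s where "s = min (1/2) (min r (Q / (3 * real n)))"
  define t where "t = sqrt s"
  have s: "0 < s" "s \<le> 1/2" "s \<le> r" "3 * real n * s \<le> Q"
  proof -
    have "3 * real n * s \<le> 3 * real n * (Q / (3 * real n))"
      by (intro mult_left_mono) (auto simp: s_def)
    then show "3 * real n * s \<le> Q" using n by simp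
  qed (use Q n r in \<open>auto simp: s_def\<close>)
  have t2: "t\<^sup>2 = s" using s by (simp add: t_def)
  then have t4: "t ^ 4 = s * s"
    by (metis numeral_Bit0 power_add power2_eq_square)
  let ?A = "alternating_tilt n \<Gamma>"
  have A: "?A u \<sigma> \<in> configs n" "\<And>i. i \<in> {1..n} \<Longrightarrow> 1 - r \<le> ?A u \<sigma> i \<bullet> \<Gamma> i"
    if "u \<in> Basis" "\<sigma>\<^sup>2 = s" for u \<sigma>
  proof -
    have sg: "((-1) ^ i * \<sigma>)\<^sup>2 = s" for i
      using that by (simp add: power_mult_distrib power_mult[symmetric])
    show "?A u \<sigma> \<in> configs n"
      unfolding configs_def alternating_tilt_def
      using that s sg configs_norm[OF \<Gamma>] by (auto intro!: norm_tilt)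
    show "1 - r \<le> ?A u \<sigma> i \<bullet> \<Gamma> i" if i: "i \<in> {1..n}" for i
      using inner_tilt_self[of u "\<Gamma> i" "(-1) ^ i * \<sigma>"] sg[of i] s \<open>u \<in> Basis\<close> configs_norm[OF \<Gamma> i] i
      by (simp add: alternating_tilt_def)
  qed
  have flip: "(-1::real) ^ ring_succ n i = - ((-1) ^ i)" if "i \<in> {1..n}" for i
    using n(2) by (auto simp: ring_succ_def)
  have pair: "?A u t i \<bullet> ?A u t (ring_succ n i) + ?A u (- t) i \<bullet> ?A u (- t) (ring_succ n i)
      = tilt t u (\<Gamma> i) \<bullet> tilt (- t) u (\<Gamma> (ring_succ n i))
        + tilt (- t) u (\<Gamma> i) \<bullet> tilt t u (\<Gamma> (ring_succ n i))" if "i \<in> {1..n}" for u i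
    using that ring_succ_in[OF that] flip[OF that]
    by (cases "even i") (simp_all add: alternating_tilt_def)
  \<comment> \<open>Neighbours carry opposite signs, also across the closing edge because n is even, so on every edge one
    end is tilted by t and the other by -t.\<close>
  have "(\<Sum>u\<in>Basis. energy n (?A u t) + energy n (?A u (- t)))
      = (\<Sum>i=1..n. \<Sum>u\<in>Basis. tilt t u (\<Gamma> i) \<bullet> tilt (- t) u (\<Gamma> (ring_succ n i))
        + tilt (- t) u (\<Gamma> i) \<bullet> tilt t u (\<Gamma> (ring_succ n i)))"
    unfolding energy_def sum.distrib[symmetric]
    by (subst sum.swap) (intro sum.cong refl pair)
  also have "\<dots> \<le> (\<Sum>i=1..n. 6 * (\<Gamma> i \<bullet> \<Gamma> (ring_succ n i))
      - 2 * t\<^sup>2 * (1 + \<Gamma> i \<bullet> \<Gamma> (ring_succ n i))\<^sup>2 + 3 * t ^ 4)"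
    using s t2 by (intro sum_mono tilt_pair_sum configs_norm[OF \<Gamma>] ring_succ_in) auto
  also have "\<dots> = 6 * energy n \<Gamma> - 2 * s * Q + 3 * real n * (s * s)"
    unfolding energy_def Q_def t2 t4 by (simp add: sum.distrib sum_subtractf sum_distrib_left)
  also have "\<dots> < 6 * energy n \<Gamma>"
  proof -
    have "s * (3 * real n * s) \<le> s * Q" using s by (intro mult_left_mono) auto
    moreover have "0 < s * Q" using s Q by simp
    ultimately show ?thesis by (simp add: algebra_simps)
  qed
  also have "\<dots> = (\<Sum>u\<in>(Basis::(real^3) set). energy n \<Gamma> + energy n \<Gamma>)" by simp
  finally obtain u where u: "u \<in> Basis" "energy n (?A u t) + energy n (?A u (- t)) < energy n \<Gamma> + energy n \<Gamma>"
    using sum_mono[of Basis "\<lambda>u. energy n \<Gamma> + energy n \<Gamma>" "\<lambda>u. energy n (?A u t) + energy n (?A u (- t))"]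
    by (meson not_less)
  then consider "energy n (?A u t) < energy n \<Gamma>" | "energy n (?A u (- t)) < energy n \<Gamma>" by linarith
  then show ?thesis
    using that A[OF u(1), of t] A[OF u(1), of "- t"] t2 by cases auto
qed

section \<open>Existence of trajectories\<close>

instance bcontfun :: (metric_space, banach) banach ..

lemma integral_upper_has_vector_derivative:
  fixes g :: "real \<Rightarrow> 'a::banach"
  assumes g: "continuous_on {0..} g" and t: "t \<ge> 0"
  shows "((\<lambda>t. integral {0..t} g) has_vector_derivative g t) (at t within {0..})"
proof -
  have "((\<lambda>t. integral {0..t} g) has_vector_derivative g t) (at t within {0..t + 1})"
    using t by (intro integral_has_vector_derivative continuous_on_subset[OF g]) auto
  also have "at t within {0..t + 1} = at t within {0..}"
    by (rule at_within_nhd[of t "{..<t + 1}"]) (use t in auto)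
  finally show ?thesis .
qed

text \<open>
  Writing a curve as \<open>exp (2 * L * t)\<close> times a bounded continuous function y, the integral operator
  contracts the supremum norm of y by one half, over the whole half-line at once. No
  gluing of local solutions is necessary. Boundedness of the field keeps the image bounded.
\<close>

lemma lipschitz_bounded_field_solution:
  fixes F :: "'a::banach \<Rightarrow> 'a"
  assumes lip: "\<And>x y. norm (F x - F y) \<le> L * norm (x - y)" and L: "L > 0"
    and bound: "\<And>x. norm (F x) \<le> B"
  obtains x where "x 0 = a" "\<And>t. t \<ge> 0 \<Longrightarrow> (x has_vector_derivative F (x t)) (at t within {0..})"
proof -
  define E where "E t = exp (2 * L * t)" for t
  have E: "E t > 0" "E 0 = 1" "continuous_on S E" for t S
    unfolding E_def by (auto intro!: continuous_intros)
  have contF: "continuous_on UNIV F"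
  proof (rule lipschitz_on_continuous_on[of L])
    show "L-lipschitz_on UNIV F"
      using lip L by (intro lipschitz_onI) (auto simp: dist_norm)
  qed
  define J where "J y t = a + integral {0..t} (\<lambda>s. F (E s *\<^sub>R apply_bcontfun y s))"
    for y :: "real \<Rightarrow>\<^sub>C 'a" and t
  have cont: "continuous_on S (\<lambda>s. F (E s *\<^sub>R apply_bcontfun y s))" for y :: "real \<Rightarrow>\<^sub>C 'a" and S
    by (intro continuous_on_compose2[OF contF] continuous_on_scaleR E(3) continuous_on_apply_bcontfun) auto
  have J: "(J y has_vector_derivative F (E t *\<^sub>R apply_bcontfun y t)) (at t within {0..})" if "t \<ge> 0" for y t
    using has_vector_derivative_add[OF has_vector_derivative_const[of a]
        integral_upper_has_vector_derivative[OF cont that]]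
    unfolding J_def by simp
  have contJ: "continuous_on {0..} (J y)" for y
    using J by (auto simp: continuous_on_eq_continuous_within intro: has_vector_derivative_continuous)
  have B: "B \<ge> 0" using bound[of 0] norm_ge_zero order_trans by blast
  \<comment> \<open>Negative times are frozen at 0, since the functions live on the whole real line.\<close>
  define P where "P y t = J y (max 0 t) /\<^sub>R E (max 0 t)" for y t
  have normJ: "norm (P y t) \<le> norm a + B / (2 * L)" for y t
  proof -
    define r where "r = max 0 t"
    have r: "r \<ge> 0" by (simp add: r_def)
    have "norm (integral {0..r} (\<lambda>s. F (E s *\<^sub>R apply_bcontfun y s))) \<le> B * (r - 0)"
      by (intro integral_bound r cont bound)
    then have "norm (J y r) \<le> norm a + B * r"
      unfolding J_def using norm_triangle_ineq[of a] by (smt (verit))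
    moreover have "norm a * 1 \<le> norm a * E r"
      using r L by (intro mult_left_mono) (auto simp: E_def)
    moreover have "B * r \<le> B / (2 * L) * E r"
    proof -
      have "2 * L * r \<le> E r" unfolding E_def using exp_ge_add_one_self[of "2 * L * r"] by linarith
      then have "B / (2 * L) * (2 * L * r) \<le> B / (2 * L) * E r"
        using B L by (intro mult_left_mono) auto
      then show ?thesis using L by simp
    qed
    ultimately have "norm (J y r) \<le> (norm a + B / (2 * L)) * E r"
      by (simp add: distrib_right)
    then show ?thesis
      unfolding P_def r_def[symmetric] using E(1)[of r] by (simp add: divide_simps)
  qed
  have contP: "continuous_on UNIV (P y)" for y
    unfolding P_def
    by (intro continuous_on_scaleR continuous_on_inverse continuous_on_compose2[OF contJ]
        continuous_on_compose2[OF E(3)[of UNIV]] continuous_intros) (auto simp: E_def)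
  define T where "T y = Bcontfun (P y)" for y
  have T: "apply_bcontfun (T y) = P y" for y
    unfolding T_def using contP normJ by (intro Bcontfun_inverse bcontfun_normI)
  have contr: "dist (T y) (T z) \<le> 1/2 * dist y z" for y z
  proof (rule dist_bound)
    fix t :: real
    define r where "r = max 0 t"
    have r: "r \<ge> 0" by (simp add: r_def)
    define D where "D = dist y z"
    let ?g = "\<lambda>y s. F (E s *\<^sub>R apply_bcontfun y s)"
    have int: "(\<lambda>s. ?g y s) integrable_on {0..r}" for y
      by (intro integrable_continuous_interval cont)
    have "((\<lambda>s. L * D * E s) has_integral (D / 2 * E r - D / 2 * E 0)) {0..r}"
      by (rule fundamental_theorem_of_calculus[OF r])
         (auto simp: E_def has_real_derivative_iff_has_vector_derivative[symmetric] intro!: derivative_eq_intros)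
    then have hi: "((\<lambda>s. L * D * E s) has_integral (D / 2 * (E r - 1))) {0..r}"
      by (simp add: E(2) right_diff_distrib)
    have "norm (integral {0..r} (\<lambda>s. ?g y s - ?g z s)) \<le> integral {0..r} (\<lambda>s. L * D * E s)"
    proof (rule integral_norm_bound_integral)
      show "(\<lambda>s. ?g y s - ?g z s) integrable_on {0..r}" by (intro integrable_diff int)
      show "(\<lambda>s. L * D * E s) integrable_on {0..r}" using hi by blast
      fix s
      have "norm (?g y s - ?g z s) \<le> L * norm (E s *\<^sub>R (apply_bcontfun y s - apply_bcontfun z s))"
        using lip by (simp add: scaleR_diff_right)
      also have "\<dots> = L * (E s * dist (apply_bcontfun y s) (apply_bcontfun z s))"
        using E(1)[of s] by (simp add: dist_norm)
      also have "\<dots> \<le> L * (E s * D)"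
        unfolding D_def using L E(1)[of s] dist_bounded[of y s z] by (intro mult_left_mono) auto
      finally show "norm (?g y s - ?g z s) \<le> L * D * E s" by (simp add: mult_ac)
    qed
    also have "\<dots> = D / 2 * (E r - 1)" using hi by (rule integral_unique)
    also have "\<dots> \<le> D / 2 * E r" by (intro mult_left_mono) (auto simp: D_def)
    also have "integral {0..r} (\<lambda>s. ?g y s - ?g z s) = J y r - J z r"
      by (simp add: J_def integral_diff[OF int int])
    finally have "norm (J y r - J z r) \<le> D / 2 * E r" .
    then have "norm ((J y r - J z r) /\<^sub>R E r) \<le> D / 2"
      using E(1)[of r] by (simp add: divide_simps)
    then show "dist (apply_bcontfun (T y) t) (apply_bcontfun (T z) t) \<le> 1/2 * dist y z"
      by (simp add: T P_def r_def D_def dist_norm scaleR_diff_right)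
  qed
  obtain y where y: "T y = y"
    using banach_fix_type[of "1/2" T] contr by auto
  have yt: "E t *\<^sub>R apply_bcontfun y t = J y t" if "t \<ge> 0" for t
  proof -
    have "apply_bcontfun y t = P y t" using T[of y] by (simp add: y)
    then show ?thesis using that E(1)[of t] by (simp add: P_def)
  qed
  show ?thesis
  proof (rule that[of "J y"])
    show "J y 0 = a" by (simp add: J_def)
    show "(J y has_vector_derivative F (J y t)) (at t within {0..})" if "t \<ge> 0" for t
      using J[OF that, of y] yt[OF that] by simp
  qed
qed

definition unit_ball_proj :: "'a::euclidean_space \<Rightarrow> 'a" where
  "unit_ball_proj = closest_point (cball 0 1)"

text \<open>
  The last item says that the projection is radial, which will keep the modified field tangent to
  the sphere through any point.
\<close>

lemma unit_ball_proj_properties: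
  fixes w :: "'a::euclidean_space"
  shows "norm (unit_ball_proj w) \<le> 1" "norm w \<le> 1 \<Longrightarrow> unit_ball_proj w = w"
    "norm (unit_ball_proj w - unit_ball_proj w') \<le> norm (w - w')"
    "\<exists>r. w = r *\<^sub>R unit_ball_proj w"
proof -
  have ne: "cball (0::'a) 1 \<noteq> {}" by simp
  show "norm (unit_ball_proj w) \<le> 1"
    using closest_point_in_set[OF closed_cball ne, of w] by (simp add: unit_ball_proj_def)
  show self: "norm w \<le> 1 \<Longrightarrow> unit_ball_proj w = w"
    by (simp add: unit_ball_proj_def closest_point_self)
  show "norm (unit_ball_proj w - unit_ball_proj w') \<le> norm (w - w')"
    using closest_point_lipschitz[OF convex_cball closed_cball ne, of w w']
    by (simp add: unit_ball_proj_def dist_norm)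
  show "\<exists>r. w = r *\<^sub>R unit_ball_proj w"
  proof (cases "norm w \<le> 1")
    case True
    then show ?thesis using self by (intro exI[of _ 1]) simp
  next
    case False
    have "w /\<^sub>R norm w = closest_point (cball 0 1) w"
    proof (rule closest_point_unique[OF convex_cball closed_cball])
      show "w /\<^sub>R norm w \<in> cball 0 1" by (simp add: divide_inverse[symmetric] mult.commute)
      have "w - w /\<^sub>R norm w = ((norm w - 1) / norm w) *\<^sub>R w"
        using False by (auto simp: diff_divide_distrib scaleR_diff_left inverse_eq_divide)
      then have "dist w (w /\<^sub>R norm w) = norm w - 1"
        using False by (auto simp: dist_norm)
      moreover have "norm w - 1 \<le> dist w z" if "z \<in> cball 0 1" for z
        using that norm_triangle_ineq2[of w z] by (simp add: dist_norm)
      ultimately show "\<forall>z\<in>cball 0 1. dist w (w /\<^sub>R norm w) \<le> dist w z" by simp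
    qed
    then have "unit_ball_proj w = w /\<^sub>R norm w" by (simp add: unit_ball_proj_def)
    moreover have "norm w \<noteq> 0" using False by linarith
    ultimately show ?thesis by (intro exI[of _ "norm w"]) simp
  qed
qed

lemma continuous_on_discrete_type: "continuous_on UNIV (f :: 'a discrete \<Rightarrow> 'b::topological_space)"
  by (simp add: continuous_on_open_vimage open_discrete)

text \<open>
  The field evaluated at the projections of all agents. It acts on sequences with the supremum
  norm, a Banach space in which the dimension need not be a type; indices have the discrete topology, for
  which continuity is no restriction.
\<close>

definition clamped_field :: "nat \<Rightarrow> (nat discrete \<Rightarrow>\<^sub>C (real^3)) \<Rightarrow> nat discrete \<Rightarrow>\<^sub>C (real^3)" where
  "clamped_field n z = Bcontfun (\<lambda>k. let i = of_discrete k in if i \<in> {1..n}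
     then ring_field n (\<lambda>j. unit_ball_proj (apply_bcontfun z (discrete j))) i else 0)"

lemma apply_clamped_field:
  "apply_bcontfun (clamped_field n z) k = (if of_discrete k \<in> {1..n}
     then ring_field n (\<lambda>j. unit_ball_proj (apply_bcontfun z (discrete j))) (of_discrete k) else 0)"
  and norm_clamped_field: "norm (clamped_field n z) \<le> 2"
proof -
  let ?f = "\<lambda>k. let i = of_discrete k in if i \<in> {1..n}
     then ring_field n (\<lambda>j. unit_ball_proj (apply_bcontfun z (discrete j))) i else 0"
  have b: "norm (?f k) \<le> 2" for k
    using ring_field_bound[OF _ unit_ball_proj_properties(1)] by (simp add: Let_def del: atLeastAtMost_iff)
  then have "?f \<in> bcontfun"
    by (intro bcontfun_normI continuous_on_discrete_type)
  then have *: "apply_bcontfun (clamped_field n z) = ?f"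
    unfolding clamped_field_def by (rule Bcontfun_inverse)
  show "apply_bcontfun (clamped_field n z) k = (if of_discrete k \<in> {1..n}
     then ring_field n (\<lambda>j. unit_ball_proj (apply_bcontfun z (discrete j))) (of_discrete k) else 0)"
    unfolding * Let_def ..
  show "norm (clamped_field n z) \<le> 2"
    by (rule norm_bound) (use b in \<open>simp only: *\<close>)
qed

lemma clamped_field_lipschitz: "norm (clamped_field n y - clamped_field n z) \<le> 6 * norm (y - z)"
proof (rule norm_bound)
  fix i
  have "norm (unit_ball_proj (apply_bcontfun y j) - unit_ball_proj (apply_bcontfun z j)) \<le> norm (y - z)" for j
    using unit_ball_proj_properties(3)[of "apply_bcontfun y j" "apply_bcontfun z j"] norm_bounded[of "y - z" j] by simp
  then show "norm (apply_bcontfun (clamped_field n y - clamped_field n z) i) \<le> 6 * norm (y - z)"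
    using unit_ball_proj_properties(1)
    by (auto simp: apply_clamped_field simp del: atLeastAtMost_iff intro!: ring_field_lipschitz)
qed

text \<open>
  Along a solution of the modified equation each agent is orthogonal to its own velocity, because the
  projection is radial. Norms are therefore constant, and on unit vectors the projection is the
  identity, so the solution solves the original equation.
\<close>

theorem trajectory_exists:
  assumes \<Gamma>: "\<Gamma> \<in> configs n"
  obtains x where "trajectory n x" "x 0 = \<Gamma>"
proof -
  define a where "a = Bcontfun (\<lambda>k::nat discrete. if of_discrete k \<in> {1..n} then \<Gamma> (of_discrete k) else 0)"
  have a: "apply_bcontfun a = (\<lambda>k. if of_discrete k \<in> {1..n} then \<Gamma> (of_discrete k) else 0)"
    unfolding a_def using configs_norm[OF \<Gamma>]
    by (intro Bcontfun_inverse bcontfun_normI[where b = 1] continuous_on_discrete_type) auto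
  obtain y where y0: "y 0 = a"
    and yd: "\<And>t. t \<ge> 0 \<Longrightarrow> (y has_vector_derivative clamped_field n (y t)) (at t within {0..})"
    using lipschitz_bounded_field_solution[of "clamped_field n" 6 2 a]
      clamped_field_lipschitz norm_clamped_field by auto
  define Y where "Y t i = apply_bcontfun (y t) (discrete i)" for t i
  define Z where "Z t j = unit_ball_proj (Y t j)" for t j
  have bl: "bounded_linear (\<lambda>f::nat discrete \<Rightarrow>\<^sub>C (real^3). apply_bcontfun f i)" for i
    by (rule bounded_linear_intro[of _ 1]) (simp_all add: norm_bounded)
  have Yd: "((\<lambda>t. Y t i) has_vector_derivative ring_field n (Z t) i) (at t within {0..})"
    if "t \<ge> 0" "i \<in> {1..n}" for t i
    using bounded_linear.has_vector_derivative[OF bl yd[OF that(1)], of "discrete i"] that(2)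
    by (simp add: Y_def Z_def[abs_def] apply_clamped_field discrete_inverse)
  have unit: "norm (Y t i) = 1" if t: "t \<ge> 0" and i: "i \<in> {1..n}" for t i
  proof -
    have "((\<lambda>t. Y t i \<bullet> Y t i) has_field_derivative 0) (at t within {0..})" if t: "t \<in> {0..}" for t
    proof -
      obtain r where r: "Y t i = r *\<^sub>R Z t i" using unit_ball_proj_properties(4) unfolding Z_def by blast
      have "ring_field n (Z t) i \<bullet> Y t i = 0"
        unfolding ring_field_def r by (simp add: dot_cross_self)
      then show ?thesis
        using bounded_bilinear.has_vector_derivative[OF bounded_bilinear_inner Yd[of t i] Yd[of t i]] t i
        by (simp add: has_real_derivative_iff_has_vector_derivative inner_commute)
    qed
    then obtain c where c: "\<And>t. t \<in> {0..} \<Longrightarrow> Y t i \<bullet> Y t i = c"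
      using has_field_derivative_zero_constant[of "{0::real..}" "\<lambda>t. Y t i \<bullet> Y t i"] by auto
    have "Y 0 i \<bullet> Y 0 i = 1" using configs_inner[OF \<Gamma> i] i by (simp add: Y_def y0 a discrete_inverse)
    then show ?thesis using c[of 0] c[of t] t by (simp add: norm_eq_1)
  qed
  define x where "x t = restrict (Y t) {1..n}" for t
  have "x 0 = \<Gamma>"
    using \<Gamma> unfolding configs_def x_def by (auto simp: Y_def y0 a discrete_inverse restrict_def PiE_def extensional_def)
  moreover have "trajectory n x"
    unfolding trajectory_def
  proof (intro conjI allI impI ballI)
    fix t :: real assume t: "t \<ge> 0"
    show "x t \<in> configs n" using unit[OF t] by (auto simp: configs_def x_def)
    fix i assume i: "i \<in> {1..n}"
    have "Z t j = x t j" if "j \<in> {1..n}" for j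
      using unit[OF t that] unit_ball_proj_properties(2)[of "Y t j"] that by (simp add: Z_def x_def)
    then have "ring_field n (Z t) i = ring_field n (x t) i"
      using ring_nbrs_subset[OF i] i unfolding ring_field_def by (simp add: subset_iff cong: sum.cong)
    then show "((\<lambda>s. x s i) has_vector_derivative ring_field n (x t) i) (at t within {0..})"
      using Yd[OF t i] i by (simp add: x_def)
  qed
  ultimately show ?thesis using that by blast
qed

section \<open>The alternating manifold\<close>

lemma unit_vectors_antipodal:
  assumes "norm x = 1" "norm y = 1" "x \<bullet> y = -1"
  shows "y = - x"
proof -
  have "(y + x) \<bullet> (y + x) = 0"
    using assms by (simp add: inner_add_left inner_add_right inner_commute norm_eq_1)
  then show ?thesis by (simp add: eq_neg_iff_add_eq_0)
qed

lemma alternating_iff_antipodal: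
  assumes n: "n \<ge> 2" "even n" and \<Gamma>: "\<Gamma> \<in> configs n"
  shows "\<Gamma> \<in> alternating_manifold n \<longleftrightarrow> (\<forall>i\<in>{1..n}. \<Gamma> i \<bullet> \<Gamma> (ring_succ n i) = -1)"
proof
  assume "\<Gamma> \<in> alternating_manifold n"
  then obtain v where v: "norm v = 1" and eq: "\<And>i. i \<in> {1..n} \<Longrightarrow> \<Gamma> i = (-1) ^ (i - 1) *\<^sub>R v"
    unfolding alternating_manifold_def by auto
  show "\<forall>i\<in>{1..n}. \<Gamma> i \<bullet> \<Gamma> (ring_succ n i) = -1"
  proof
    fix i assume i: "i \<in> {1..n}"
    obtain k where k: "i = Suc k" using i by (cases i) auto
    have "(-1::real) ^ k * (-1) ^ (ring_succ n i - 1) = -1"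
      using n(2) k by (auto simp: ring_succ_def power_add[symmetric])
    then show "\<Gamma> i \<bullet> \<Gamma> (ring_succ n i) = -1"
      using eq[OF i] eq[OF ring_succ_in[OF i]] v k by (simp add: norm_eq_1 mult.commute)
  qed
next
  assume anti: "\<forall>i\<in>{1..n}. \<Gamma> i \<bullet> \<Gamma> (ring_succ n i) = -1"
  then have neg: "\<Gamma> (ring_succ n i) = - \<Gamma> i" if "i \<in> {1..n}" for i
    using that
    by (intro unit_vectors_antipodal[OF configs_norm[OF \<Gamma> that] configs_norm[OF \<Gamma> ring_succ_in[OF that]]]) blast
  have pow: "Suc k \<le> n \<Longrightarrow> \<Gamma> (Suc k) = (-1) ^ k *\<^sub>R \<Gamma> 1" for k
  proof (induction k)
    case (Suc k)
    then have "\<Gamma> (Suc (Suc k)) = - \<Gamma> (Suc k)"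
      using neg[of "Suc k"] by (auto simp: ring_succ_def)
    then show ?case using Suc by simp
  qed simp
  have "\<Gamma> i = (-1) ^ (i - 1) *\<^sub>R \<Gamma> 1" if "i \<in> {1..n}" for i
    using pow[of "i - 1"] that by simp
  moreover have "\<Gamma> 1 \<in> sphere 0 1" using configs_norm[OF \<Gamma>, of 1] n by simp
  ultimately have "\<exists>v\<in>sphere 0 1. \<forall>i\<in>{1..n}. \<Gamma> i = (-1) ^ (i - 1) *\<^sub>R v"
    by (intro bexI[where x = "\<Gamma> 1"] ballI) assumption+
  with \<Gamma> show "\<Gamma> \<in> alternating_manifold n"
    unfolding alternating_manifold_def mem_Collect_eq by (rule conjI)
qed

text \<open>
  Every edge contributes at least -1 to the energy, with equality for antipodal neighbours only.
\<close>

lemma alternating_iff_energy: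
  assumes n: "n \<ge> 2" "even n" and \<Gamma>: "\<Gamma> \<in> configs n"
  shows "\<Gamma> \<in> alternating_manifold n \<longleftrightarrow> energy n \<Gamma> \<le> - real n"
proof -
  have nonneg: "0 \<le> 1 + \<Gamma> i \<bullet> \<Gamma> (ring_succ n i)" if "i \<in> {1..n}" for i
    using inner_bounds_unit(1)[of "\<Gamma> i" "\<Gamma> (ring_succ n i)"] configs_norm[OF \<Gamma>] that ring_succ_in by simp
  have eq: "(\<Sum>i=1..n. 1 + \<Gamma> i \<bullet> \<Gamma> (ring_succ n i)) = real n + energy n \<Gamma>"
    by (simp add: energy_def sum.distrib)
  have "energy n \<Gamma> \<le> - real n \<longleftrightarrow> (\<Sum>i=1..n. 1 + \<Gamma> i \<bullet> \<Gamma> (ring_succ n i)) = 0"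
    using sum_nonneg[of "{1..n}" "\<lambda>i. 1 + \<Gamma> i \<bullet> \<Gamma> (ring_succ n i)"] nonneg unfolding eq by auto
  also have "\<dots> \<longleftrightarrow> (\<forall>i\<in>{1..n}. 1 + \<Gamma> i \<bullet> \<Gamma> (ring_succ n i) = 0)"
    by (rule sum_nonneg_eq_0_iff) (use nonneg in auto)
  also have "\<dots> \<longleftrightarrow> \<Gamma> \<in> alternating_manifold n"
    unfolding alternating_iff_antipodal[OF assms] by (intro ball_cong refl) linarith
  finally show ?thesis by blast
qed

lemma alternating_subset: "alternating_manifold n \<subseteq> configs n"
  unfolding alternating_manifold_def by (rule Collect_restrict)

lemma alternating_energy:
  assumes n: "n \<ge> 2" "even n" and \<Gamma>: "\<Gamma> \<in> alternating_manifold n"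
  shows "energy n \<Gamma> = - real n"
proof -
  have "\<Gamma> \<in> configs n" using \<Gamma> alternating_subset by blast
  then show ?thesis
    using alternating_iff_energy[OF n] \<Gamma> energy_lower[of \<Gamma> n] by force
qed

lemma alternating_equilibria:
  assumes n: "n \<ge> 2" "even n"
  shows "alternating_manifold n \<subseteq> equilibria n"
proof
  fix \<Gamma> assume \<Gamma>: "\<Gamma> \<in> alternating_manifold n"
  then have cf: "\<Gamma> \<in> configs n" using alternating_subset by blast
  have anti: "\<Gamma> i \<bullet> \<Gamma> (ring_succ n i) = -1" if "i \<in> {1..n}" for i
    using \<Gamma> that unfolding alternating_iff_antipodal[OF n cf] by blast
  have neg: "\<Gamma> (ring_succ n i) = - \<Gamma> i" if "i \<in> {1..n}" for i
    by (rule unit_vectors_antipodal[OF configs_norm[OF cf that] configs_norm[OF cf ring_succ_in[OF that]] anti[OF that]])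
  have "ring_field n \<Gamma> i = 0" if i: "i \<in> {1..n}" for i
  proof -
    have "\<Gamma> (ring_pred n i) = - \<Gamma> i"
      using neg[OF ring_pred_in[OF i]] ring_succ_pred[OF i] by simp
    then have h: "\<Gamma> (ring_pred n i) + \<Gamma> (ring_succ n i) = (-2) *\<^sub>R \<Gamma> i"
      by (simp only: neg[OF i] scaleR_minus_left scaleR_2 minus_add_distrib)
    show ?thesis
      unfolding ring_field_eq[OF n(1) cf i] h inner_scaleR_right configs_inner[OF cf i] by simp
  qed
  then show "\<Gamma> \<in> equilibria n" using cf by (simp add: equilibria_def)
qed

lemma alternating_manifold_eq_image:
  "alternating_manifold n = (\<lambda>v. \<lambda>i\<in>{1..n}. (-1) ^ (i - 1) *\<^sub>R v) ` sphere 0 1"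
    (is "_ = ?g ` _")
proof
  show "?g ` sphere 0 1 \<subseteq> alternating_manifold n"
  proof (rule image_subsetI)
    fix v :: "real^3" assume v: "v \<in> sphere 0 1"
    have c: "?g v \<in> configs n" using v by (simp add: configs_def restrict_PiE_iff)
    have e: "\<forall>i\<in>{1..n}. ?g v i = (-1) ^ (i - 1) *\<^sub>R v" by simp
    show "?g v \<in> alternating_manifold n"
      unfolding alternating_manifold_def
      by (rule CollectI, rule conjI, rule c, rule bexI[where x = v], rule e, rule v)
  qed
  show "alternating_manifold n \<subseteq> ?g ` sphere 0 1"
  proof
    fix \<Gamma> assume "\<Gamma> \<in> alternating_manifold n"
    then obtain v where cf: "\<Gamma> \<in> configs n" and v: "v \<in> sphere 0 1"
      and eq: "\<And>i. i \<in> {1..n} \<Longrightarrow> \<Gamma> i = (-1) ^ (i - 1) *\<^sub>R v"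
      unfolding alternating_manifold_def by blast
    have "\<Gamma> = ?g v"
    proof (rule extensionalityI[where A = "{1..n}"])
      show "\<Gamma> \<in> extensional {1..n}" using cf by (simp add: configs_def PiE_def)
      show "?g v \<in> extensional {1..n}" by (rule restrict_extensional)
      show "\<Gamma> i = ?g v i" if "i \<in> {1..n}" for i
        using eq[OF that] that by simp
    qed
    then show "\<Gamma> \<in> ?g ` sphere 0 1" by (rule image_eqI[OF _ v])
  qed
qed

lemma alternating_nonempty: "alternating_manifold n \<noteq> {}"
  by (simp add: alternating_manifold_eq_image)

lemma connected_alternating: "connected (alternating_manifold n)"
  unfolding alternating_manifold_eq_image
proof (rule connected_continuous_image)
  show "connected (sphere (0::real^3) 1)" by (rule connected_sphere) simp
  show "continuous_on (sphere 0 1) (\<lambda>v::real^3. \<lambda>i\<in>{1..n}. (-1) ^ (i - 1) *\<^sub>R v)"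
  proof (rule continuous_on_coordinatewise_then_product)
    fix i
    show "continuous_on (sphere 0 1) (\<lambda>v::real^3. (\<lambda>i\<in>{1..n}. (-1) ^ (i - 1) *\<^sub>R v) i)"
    proof (cases "i \<in> {1..n}")
      case True
      then show ?thesis by (simp add: continuous_on_scaleR)
    next
      case False
      then show ?thesis by (simp only: restrict_apply if_False continuous_on_const)
    qed
  qed
qed

text \<open>
  On a connected set of equilibria the energy takes finitely many values and hence one. If the set contains an
  alternating configuration, this value is the minimum, which only alternating configurations attain.
\<close>

theorem alternating_is_equilibrium_manifold:
  assumes n: "n \<ge> 2" "even n"
  shows "alternating_manifold n \<in> equilibrium_manifolds n"
  unfolding equilibrium_manifolds_def in_components_maximal
proof (intro conjI allI impI alternating_nonempty alternating_equilibria[OF n] connected_alternating)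
  fix D assume D: "D \<noteq> {} \<and> alternating_manifold n \<subseteq> D \<and> D \<subseteq> equilibria n \<and> connected D"
  have "connected (energy n ` D)"
    using D by (intro connected_continuous_image continuous_on_energy) auto
  moreover have "finite (energy n ` D)"
    using D finite_critical_values[OF n(1)] by (meson finite_subset image_mono)
  ultimately obtain e where e: "energy n ` D = {e}"
    using D connected_finite_iff_sing by blast
  obtain \<Gamma>0 where "\<Gamma>0 \<in> alternating_manifold n" using alternating_nonempty by blast
  then have "- real n \<in> energy n ` D"
    using D alternating_energy[OF n] by (metis imageI subsetD)
  then have e_eq: "e = - real n" by (simp add: e)
  have "\<Gamma> \<in> alternating_manifold n" if "\<Gamma> \<in> D" for \<Gamma>
  proof -
    have "\<Gamma> \<in> configs n" using that D by (auto simp: equilibria_def)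
    moreover have "energy n \<Gamma> \<in> {e}" using that unfolding e[symmetric] by (rule imageI)
    then have "energy n \<Gamma> = - real n" using e_eq by simp
    ultimately show ?thesis using alternating_iff_energy[OF n] by simp
  qed
  then show "D = alternating_manifold n" using D by blast
qed

text \<open>
  Outside a given neighbourhood the energy exceeds the minimum by a positive amount; configurations
  near enough to the manifold lie below that level, and the energy never increases.
\<close>

theorem alternating_stable:
  assumes n: "n \<ge> 2" "even n"
  shows "stable_set n (alternating_manifold n)"
proof -
  let ?M = "alternating_manifold n"
  have n1: "n \<ge> 1" using n by simp
  note MP = equilibrium_manifold_props[OF alternating_is_equilibrium_manifold[OF n]]
  have "positively_invariant n ?M"
    unfolding positively_invariant_def
  proof (intro conjI alternating_subset allI impI)
    fix x and t :: real assume x: "trajectory n x" "x 0 \<in> ?M" "t \<ge> 0"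
    have "energy n (x t) \<le> - real n"
      using energy_antimono[OF n(1) x(1), of 0 t] alternating_energy[OF n x(2)] x(3) by simp
    then show "x t \<in> ?M"
      using alternating_iff_energy[OF n trajectory_in_configs[OF x(1,3)]] by simp
  qed
  moreover have "\<exists>\<delta>>0. \<forall>x. trajectory n x \<longrightarrow> config_setdist n ?M (x 0) < \<delta> \<longrightarrow>
      (\<forall>t\<ge>0. config_setdist n ?M (x t) < \<epsilon>)" if \<epsilon>: "\<epsilon> > 0" for \<epsilon>
  proof -
    define K where "K = {\<Gamma> \<in> configs n. \<epsilon> \<le> config_setdist n ?M \<Gamma>}"
    have "compact (configs n \<inter> K)"
      unfolding K_def
      by (rule compact_Int_closed[OF compact_configs closed_config_setdist_ge[OF n1 MP(3,2)]])
    also have "configs n \<inter> K = K" by (auto simp: K_def)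
    finally have K: "compact K" .
    have "\<exists>m. - real n < m \<and> (\<forall>\<Gamma>\<in>K. m \<le> energy n \<Gamma>)"
    proof (cases "K = {}")
      case True
      then show ?thesis by (intro exI[of _ "- real n + 1"]) simp
    next
      case False
      then obtain p where p: "p \<in> K" "\<And>\<Gamma>. \<Gamma> \<in> K \<Longrightarrow> energy n p \<le> energy n \<Gamma>"
        using continuous_attains_inf[OF K _ continuous_on_energy] by blast
      have "p \<notin> ?M"
      proof
        assume "p \<in> ?M"
        then have "config_setdist n ?M p = 0" by (rule config_setdist_member[OF n1 MP(3)])
        then show False using p(1) \<epsilon> by (simp add: K_def)
      qed
      moreover have "p \<in> configs n" using p(1) by (simp add: K_def)
      ultimately have "- real n < energy n p"
        using alternating_iff_energy[OF n, of p] by simp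
      then show ?thesis using p(2) by blast
    qed
    then obtain m where m: "- real n < m" "\<And>\<Gamma>. \<Gamma> \<in> K \<Longrightarrow> m \<le> energy n \<Gamma>" by blast
    define H where "H = configs n \<inter> {\<Gamma>. m \<le> energy n \<Gamma>}"
    have "compact H"
      unfolding H_def
      by (intro compact_Int_closed compact_configs closed_Collect_le continuous_on_energy continuous_on_const)
    moreover have "H \<subseteq> configs n" by (simp add: H_def)
    moreover have "H \<inter> ?M = {}"
      using m(1) alternating_energy[OF n] unfolding H_def disjoint_iff by (metis Int_iff mem_Collect_eq not_less)
    ultimately obtain \<delta> where \<delta>: "\<delta> > 0" "\<And>\<Gamma>. \<Gamma> \<in> H \<Longrightarrow> \<delta> \<le> config_setdist n ?M \<Gamma>"
      by (rule config_setdist_pos_on_disjoint_compact[OF n1 MP(1,3,2)]) blast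
    have "config_setdist n ?M (x t) < \<epsilon>"
      if x: "trajectory n x" "config_setdist n ?M (x 0) < \<delta>" and t: "t \<ge> 0" for x t
    proof -
      have "x 0 \<notin> H" using \<delta>(2)[of "x 0"] x(2) by auto
      then have "energy n (x 0) < m"
        using trajectory_in_configs[OF x(1), of 0] by (simp add: H_def)
      then have "energy n (x t) < m"
        using energy_antimono[OF n(1) x(1) _ t] by simp
      then have "x t \<notin> K" using m(2)[of "x t"] by auto
      then show ?thesis
        using trajectory_in_configs[OF x(1) t] by (simp add: K_def)
    qed
    then show ?thesis using \<delta>(1) by blast
  qed
  ultimately show ?thesis unfolding stable_set_def by blast
qed

text \<open>
  The start must be chosen near a point of least energy of M: then every point of M has at least
  this energy, whereas the energy along the trajectory tends to an equilibrium energy strictly below it.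
\<close>

theorem other_manifolds_unstable:
  assumes n: "n \<ge> 2" "even n" and M: "M \<in> equilibrium_manifolds n" and neq: "M \<noteq> alternating_manifold n"
  shows "\<not> stable_set n M"
proof
  assume "stable_set n M"
  then have stable: "\<exists>\<delta>>0. \<forall>x. trajectory n x \<longrightarrow> config_setdist n M (x 0) < \<delta> \<longrightarrow>
      (\<forall>t\<ge>0. config_setdist n M (x t) < \<epsilon>)" if "\<epsilon> > 0" for \<epsilon>
    using that unfolding stable_set_def by blast
  have n1: "n \<ge> 1" using n by simp
  note MP = equilibrium_manifold_props[OF M]
  have disj: "M \<inter> alternating_manifold n = {}"
    using M alternating_is_equilibrium_manifold[OF n] neq
    unfolding equilibrium_manifolds_def by (metis components_eq)
  obtain p where p: "p \<in> M" "\<And>q. q \<in> M \<Longrightarrow> energy n p \<le> energy n q"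
    using continuous_attains_inf[OF MP(1,2) continuous_on_energy] by blast
  have pc: "p \<in> configs n" using p MP by blast
  obtain j where j: "j \<in> {1..n}" "p j \<bullet> p (ring_succ n j) \<noteq> -1"
    using alternating_iff_antipodal[OF n pc] disj p(1) by blast
  \<comment> \<open>A level strictly between the energy of p and the next lower equilibrium energy, if there is one.\<close>
  obtain v where v: "v < energy n p" "\<And>q. q \<in> equilibria n \<Longrightarrow> energy n q < energy n p \<Longrightarrow> energy n q < v"
  proof -
    let ?C = "{c \<in> energy n ` equilibria n. c < energy n p}"
    have fin: "finite (insert (energy n p - 1) ?C)" using finite_critical_values[OF n(1)] by simp
    define c where "c = Max (insert (energy n p - 1) ?C)"
    have "c \<in> insert (energy n p - 1) ?C" unfolding c_def by (rule Max_in[OF fin]) simp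
    then have "c < energy n p" by auto
    moreover have "energy n q \<le> c" if "q \<in> equilibria n" "energy n q < energy n p" for q
      unfolding c_def by (rule Max_ge[OF fin]) (use that in auto)
    ultimately show ?thesis
      using that[of "(c + energy n p) / 2"] by force
  qed
  define K where "K = configs n \<inter> {\<Gamma>. energy n \<Gamma> \<le> v}"
  have "compact K"
    unfolding K_def
    by (intro compact_Int_closed compact_configs closed_Collect_le continuous_on_energy continuous_on_const)
  moreover have "K \<subseteq> configs n" by (simp add: K_def)
  moreover have "K \<inter> M = {}"
    using p(2) v(1) unfolding K_def disjoint_iff by (metis Int_iff mem_Collect_eq not_less order.trans)
  ultimately obtain \<epsilon> where \<epsilon>: "\<epsilon> > 0" "\<And>\<Gamma>. \<Gamma> \<in> K \<Longrightarrow> \<epsilon> \<le> config_setdist n M \<Gamma>"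
    by (rule config_setdist_pos_on_disjoint_compact[OF n1 MP(1,3,2)]) blast
  obtain \<delta> where \<delta>: "\<delta> > 0" and close: "\<And>x t. trajectory n x \<Longrightarrow> config_setdist n M (x 0) < \<delta> \<Longrightarrow>
      t \<ge> 0 \<Longrightarrow> config_setdist n M (x t) < \<epsilon>"
    using stable[OF \<epsilon>(1)] by blast
  \<comment> \<open>Angles are at most pi, so the cosine is inverted on the interval from 0 to pi only.\<close>
  define \<theta> where "\<theta> = min \<delta> pi"
  have \<theta>: "0 < \<theta>" "\<theta> \<le> pi" "\<theta> \<le> \<delta>" using \<delta> by (auto simp: \<theta>_def)
  have "cos \<theta> < cos 0" using \<theta> by (intro cos_monotone_0_pi) auto
  then have "0 < (1 - cos \<theta>) / 2" by simp
  then obtain \<Gamma> where \<Gamma>: "\<Gamma> \<in> configs n" "energy n \<Gamma> < energy n p"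
    and near: "\<And>i. i \<in> {1..n} \<Longrightarrow> 1 - (1 - cos \<theta>) / 2 \<le> \<Gamma> i \<bullet> p i"
    using energy_descent_near_nonalternating[OF n pc j] by metis
  have "arccos (\<Gamma> i \<bullet> p i) < \<delta>" if i: "i \<in> {1..n}" for i
  proof -
    have "cos \<theta> < 1 - (1 - cos \<theta>) / 2" using \<open>cos \<theta> < cos 0\<close> by (simp add: field_simps)
    then have "cos \<theta> < \<Gamma> i \<bullet> p i" using near[OF i] by (rule order.strict_trans2)
    then have "arccos (\<Gamma> i \<bullet> p i) < arccos (cos \<theta>)"
      using angle_bounds(2)[OF \<Gamma>(1) pc i] by (intro arccos_less_arccos) auto
    also have "\<dots> = \<theta>" using \<theta> by (intro arccos_cos) auto
    finally show ?thesis using \<theta> by simp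
  qed
  then have "config_dist n \<Gamma> p < \<delta>" by (simp add: config_dist_less_iff[OF n1])
  then have start: "config_setdist n M \<Gamma> < \<delta>"
    using config_setdist_le[OF n1 \<Gamma>(1) MP(3) p(1)] by simp
  obtain x where x: "trajectory n x" "x 0 = \<Gamma>"
    using trajectory_exists[OF \<Gamma>(1)] by blast
  obtain q where q: "q \<in> equilibria n" "energy n q \<le> energy n (x 0)"
    "\<And>u. energy n q < u \<Longrightarrow> \<exists>t\<ge>0. energy n (x t) < u"
    using energy_limit[OF n(1) x(1)] by blast
  have "energy n q < v" using v(2)[OF q(1)] q(2) \<Gamma>(2) x(2) by simp
  then obtain t where t: "t \<ge> 0" "energy n (x t) < v" using q(3) by blast
  then have "x t \<in> K" using trajectory_in_configs[OF x(1)] by (simp add: K_def)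
  then show False
    using \<epsilon>(2)[of "x t"] close[OF x(1) _ t(1)] start x(2) by simp
qed

theorem theorem4p5:
  fixes n :: nat
  assumes "n \<ge> 2" and "even n"
  shows "(\<forall>x. trajectory n x \<longrightarrow> (\<exists>M\<in>equilibrium_manifolds n. approaches n x M)) \<and>
    alternating_manifold n \<in> equilibrium_manifolds n \<and>
    (\<forall>M\<in>equilibrium_manifolds n. stable_set n M \<longleftrightarrow> M = alternating_manifold n)"
  using trajectory_approaches_equilibrium_manifold[OF assms(1)]
    alternating_is_equilibrium_manifold[OF assms] alternating_stable[OF assms]
    other_manifolds_unstable[OF assms] by blast

end
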